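(* Let $p$ be a prime, $q=p^e$ with $e\ge 1$, let $R$ be a normal integral $F$-finite $\mathbb F_p$-algebra and let $\phi\colon F^e_*R\to R$ be a surjective $R$-linear map. Let $\theta\colon R\subset S$ be a finite extension with $S$ a normal integral domain, and let $\psi\colon F^e_*S\to S$ be an $S$-linear map extending $\phi$. Let $f\colon \operatorname{Spec}S\to\operatorname{Spec}R$ be the map $\mathfrak q\mapsto\mathfrak q\cap R$. Then the following statements are equivalent: (a) The map $f$, viewed as a map $\mathrm{CZpec}(S,\psi)\to\mathrm{CZpec}(R,\phi)$, is continuous. (b) The square formed by $f\colon\mathrm{CZpec}(S,\psi)\to\mathrm{CZpec}(R,\phi)$, its restriction $\mathrm{Schpec}(S,\psi)\to\mathrm{Schpec}(R,\phi)$, and the maps $\beta(S,\psi)\colon \mathrm{CZpec}(S,\psi)\to\mathrm{Schpec}(S,\psi)$ and $\beta(R,\phi)\colon \mathrm{CZpec}(R,\phi)\to\mathrm{Schpec}(R,\phi)$ is commutative, i.e. $\beta_{\mathfrak q}(S,\psi)\cap R=\beta_{\mathfrak q\cap R}(R,\phi)$ for all $\mathfrak q\in\operatorname{Spec}S$. (c) For all $\mathfrak p\in\operatorname{Spec}R$, the equality of ideals of $S$ $$\sqrt{\beta_{\mathfrak p}(R,\phi)S}=\bigcap_{\mathfrak q\in\operatorname{Ass}_S S/\sqrt{\mathfrak pS}}\beta_{\mathfrak q}(S,\psi)$$ holds. (d) For all $\mathfrak p\in\operatorname{Spec}R$, the equality $f^{-1}\{\beta_{\mathfrak p}(R,\phi)\}=\beta(S,\psi)\big(f^{-1}\{\mathfrak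 p\}\big)$ of subsets of $\operatorname{Spec}S$ holds. (e) The equality $\mathrm{Schpec}(S,\psi)=f^{-1}\big(\mathrm{Schpec}(R,\phi)\big)$ of subsets of $\operatorname{Spec}S$ holds.
   Context: All rings are noetherian. $F^e_*R$ is $R$ viewed as an $R$-module via the $e$-th Frobenius $r\mapsto r^q$; $R$ is $F$-finite if $F_*R$ is finitely generated. "$\psi$ extends $\phi$" means $\psi(F^e_*r)=\phi(F^e_*r)$ for all $r\in R$. Powers: $\phi^0=\mathrm{id}_R$ and $\phi^{n}=\phi\circ F^e_*\phi^{n-1}\colon F^{en}_*R\to R$ (similarly for $\psi$). For an ideal $\mathfrak a\subset R$, $\mathfrak a^{\phi^n}=\{r\in R\mid \phi^n(F^{en}_*(rR))\subset\mathfrak a\}$. A $\phi$-ideal is an ideal $\mathfrak a$ with $\phi(F^e_*\mathfrak a)\subset\mathfrak a$; $I(R,\phi)$ is the set of $\phi$-ideals. $\mathrm{Schpec}(R,\phi)$ is the set of prime $\phi$-ideals $\mathfrak p$ with $\phi(F^e_*R)\not\subset\mathfrak p$ (the centers of $F$-purity; as $\phi$ is surjective these are just all the prime $\phi$-ideals), with the subspace topology from $\operatorname{Spec}R$. The Cartier core map $\beta=\beta(R,\phi)\colon\operatorname{Spec}R\to\mathrm{Schpec}(R,\phi)$ sends $\mathfrak p$ to $\beta_{\mathfrak p}=\beta_{\mathfrak p}(R,\phi)=\bigcap_{n\ge0}\mathfrak p^{\phi^n}$ (which is a center of $F$-purity). $\mathrm{CZpec}(R,\phi)$ is the set $\operatorname{Spec}R$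 with the Cartier--Zariski topology, whose closed sets are the sets $V(\mathfrak a)$ with $\mathfrak a\in I(R,\phi)$. The same definitions are used for $(S,\psi)$ (note $\psi$ is automatically surjective). A $\psi$-ideal contracts to a $\phi$-ideal, so $f$ restricts to $\mathrm{Schpec}(S,\psi)\to\mathrm{Schpec}(R,\phi)$. *)

theory Defs
  imports
    "HOL-Analysis.Abstract_Topology"
    "HOL-Computational_Algebra.Polynomial_Factorial"
begin

section \<open>Ideals and spectra\<close>

text \<open>Rings are represented by types: a ring is a type of class \<open>comm_ring_1\<close>, a domain a type of
  class \<open>idom\<close>. An ideal is a submodule of the ring regarded as a module over itself.\<close>

abbreviation is_ideal :: "'a::comm_ring_1 set \<Rightarrow> bool" where
  "is_ideal \<equiv> module.subspace (*)"

abbreviation ideal_gen :: "'a::comm_ring_1 set \<Rightarrow> 'a set" where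
  "ideal_gen \<equiv> module.span (*)"

definition prime_ideal :: "'a::comm_ring_1 set \<Rightarrow> bool" where
  "prime_ideal P \<longleftrightarrow>
     is_ideal P \<and> P \<noteq> UNIV \<and> (\<forall>x y. x * y \<in> P \<longrightarrow> x \<in> P \<or> y \<in> P)"

definition Spec :: "'a::comm_ring_1 set set" where
  "Spec = {P. prime_ideal P}"

definition zero_locus :: "'a::comm_ring_1 set \<Rightarrow> 'a set set" where
  "zero_locus I = {P \<in> Spec. I \<subseteq> P}"

definition radical :: "'a::comm_ring_1 set \<Rightarrow> 'a set" where
  "radical I = {x. \<exists>n. x ^ n \<in> I}"

text \<open>The associated primes of the module \<open>A/J\<close> over the ring \<open>A\<close>: the annihilator of the class of
  \<open>x\<close> is the ideal of all \<open>a\<close> with \<open>a * x \<in> J\<close>.\<close>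

definition Ass_quotient :: "'a::comm_ring_1 set \<Rightarrow> 'a set set" where
  "Ass_quotient J = {P \<in> Spec. \<exists>x. P = {a. a * x \<in> J}}"

definition noetherian :: "'a::comm_ring_1 itself \<Rightarrow> bool" where
  "noetherian _ \<longleftrightarrow> (\<forall>I::'a set. is_ideal I \<longrightarrow> (\<exists>B. finite B \<and> ideal_gen B = I))"

definition integrally_closed :: "'a::idom itself \<Rightarrow> bool" where
  "integrally_closed _ \<longleftrightarrow>
     (\<forall>x::'a fract. (\<exists>P::'a poly. lead_coeff P = 1 \<and> poly (map_poly to_fract P) x = 0)
        \<longrightarrow> x \<in> range to_fract)"

definition ring_embedding :: "('a::comm_ring_1 \<Rightarrow> 'b::comm_ring_1) \<Rightarrow> bool" where
  "ring_embedding \<theta> \<longleftrightarrow>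
     inj \<theta> \<and> \<theta> 1 = 1 \<and> (\<forall>x y. \<theta> (x + y) = \<theta> x + \<theta> y) \<and> (\<forall>x y. \<theta> (x * y) = \<theta> x * \<theta> y)"

definition finite_extension :: "('a::comm_ring_1 \<Rightarrow> 'b::comm_ring_1) \<Rightarrow> bool" where
  "finite_extension \<theta> \<longleftrightarrow>
     ring_embedding \<theta> \<and> (\<exists>B. finite B \<and> module.span (\<lambda>r s. \<theta> r * s) B = UNIV)"

definition contract :: "('a::comm_ring_1 \<Rightarrow> 'b::comm_ring_1) \<Rightarrow> 'b set \<Rightarrow> 'a set" where
  "contract \<theta> J = \<theta> -` J"

definition extend :: "('a::comm_ring_1 \<Rightarrow> 'b::comm_ring_1) \<Rightarrow> 'a set \<Rightarrow> 'b set" where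
  "extend \<theta> I = ideal_gen (\<theta> ` I)"

lemma module_mult: "module ((*) :: 'a::comm_ring_1 \<Rightarrow> 'a \<Rightarrow> 'a)"
  by unfold_locales (simp_all add: algebra_simps)


section \<open>Frobenius and Cartier maps\<close>

text \<open>The module \<open>F\<^sup>e\<^sub>*R\<close> is the additive group of the ring with the scalar multiplication below, for
  \<open>q = p ^ e\<close>. Its elements \<open>F\<^sup>e\<^sub>*r\<close> are identified with \<open>r\<close>, so that an \<open>R\<close>-linear map
  \<open>F\<^sup>e\<^sub>*R \<rightarrow> R\<close> is a function on the ring, and its powers are iterates of that function.\<close>

definition frob_scale :: "nat \<Rightarrow> 'a::comm_ring_1 \<Rightarrow> 'a \<Rightarrow> 'a" where
  "frob_scale q r x = r ^ q * x"

definition frob_linear :: "nat \<Rightarrow> ('a::comm_ring_1 \<Rightarrow> 'a) \<Rightarrow> bool" where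
  "frob_linear q \<phi> \<longleftrightarrow> module_hom (frob_scale q) (*) \<phi>"

definition F_finite :: "'a::comm_ring_1 itself \<Rightarrow> bool" where
  "F_finite _ \<longleftrightarrow> (\<exists>B::'a set. finite B \<and> module.span (frob_scale CHAR('a)) B = UNIV)"

definition ideal_root :: "('a::comm_ring_1 \<Rightarrow> 'a) \<Rightarrow> nat \<Rightarrow> 'a set \<Rightarrow> 'a set" where
  "ideal_root \<phi> n I = {r. (\<phi> ^^ n) ` ideal_gen {r} \<subseteq> I}"

definition phi_ideals :: "('a::comm_ring_1 \<Rightarrow> 'a) \<Rightarrow> 'a set set" where
  "phi_ideals \<phi> = {I. is_ideal I \<and> \<phi> ` I \<subseteq> I}"

definition Schpec :: "('a::comm_ring_1 \<Rightarrow> 'a) \<Rightarrow> 'a set set" where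
  "Schpec \<phi> = {P \<in> Spec. P \<in> phi_ideals \<phi> \<and> \<not> range \<phi> \<subseteq> P}"

definition cartier_core :: "('a::comm_ring_1 \<Rightarrow> 'a) \<Rightarrow> 'a set \<Rightarrow> 'a set" where
  "cartier_core \<phi> P = (\<Inter>n. ideal_root \<phi> n P)"

definition CZpec :: "('a::comm_ring_1 \<Rightarrow> 'a) \<Rightarrow> 'a set topology" where
  "CZpec \<phi> = topology (\<lambda>U. \<exists>I\<in>phi_ideals \<phi>. U = Spec - zero_locus I)"

text \<open>For a prime characteristic, the scalar multiplication does define a module.\<close>

lemma module_frob_scale:
  assumes "prime CHAR('a::comm_ring_1)"
  shows "module (frob_scale (CHAR('a) ^ e) :: 'a \<Rightarrow> 'a \<Rightarrow> 'a)"
  by unfold_locales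
    (simp_all add: frob_scale_def algebra_simps freshmans_dream'[OF assms refl])

text \<open>For a linear map \<open>\<phi>\<close>, the sets used to define \<^term>\<open>CZpec \<phi>\<close> do form a topology.\<close>

lemma istopology_CZpec:
  fixes \<phi> :: "'a::comm_ring_1 \<Rightarrow> 'a"
  assumes "frob_linear q \<phi>"
  shows "istopology (\<lambda>U. \<exists>I\<in>phi_ideals \<phi>. U = Spec - zero_locus I)"
proof -
  interpret R: module "(*) :: 'a \<Rightarrow> 'a \<Rightarrow> 'a" by (rule module_mult)
  interpret \<phi>: module_hom "frob_scale q" "(*)" \<phi>
    using assms by (simp add: frob_linear_def)
  have zl_Int: "zero_locus (I \<inter> J) = zero_locus I \<union> zero_locus J"
    if I: "is_ideal I" and J: "is_ideal J" for I J :: "'a set"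
  proof
    show "zero_locus (I \<inter> J) \<subseteq> zero_locus I \<union> zero_locus J"
    proof
      fix P assume P: "P \<in> zero_locus (I \<inter> J)"
      show "P \<in> zero_locus I \<union> zero_locus J"
      proof (rule ccontr)
        assume "P \<notin> zero_locus I \<union> zero_locus J"
        then obtain x y where xy: "x \<in> I" "x \<notin> P" "y \<in> J" "y \<notin> P"
          using P by (auto simp: zero_locus_def)
        have "x * y \<in> J" using R.subspace_scale[OF J xy(3)] .
        moreover have "x * y \<in> I"
          using R.subspace_scale[OF I xy(1), of y] by (simp add: mult.commute)
        ultimately have "x * y \<in> P" using P by (auto simp: zero_locus_def)
        then show False
          using P xy by (auto simp: zero_locus_def Spec_def prime_ideal_def)
      qed
    qed
  qed (auto simp: zero_locus_def)
  have Int: "I \<inter> J \<in> phi_ideals \<phi>" if "I \<in> phi_ideals \<phi>" "J \<in> phi_ideals \<phi>" for I J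
    using that by (auto simp: phi_ideals_def intro: R.subspace_inter)
  have Sum: "ideal_gen (\<Union>\<K>) \<in> phi_ideals \<phi>" if K: "\<K> \<subseteq> phi_ideals \<phi>" for \<K>
  proof -
    have "\<phi> x \<in> ideal_gen (\<Union>\<K>)" if "x \<in> ideal_gen (\<Union>\<K>)" for x
      using that
    proof (induction rule: R.span_induct_alt)
      case base
      then show ?case by (simp add: R.span_zero)
    next
      case (step c x y)
      then obtain I where I: "I \<in> \<K>" "x \<in> I" by auto
      then have "\<phi> (c * x) \<in> I"
        using K by (auto simp: phi_ideals_def image_subset_iff dest: R.subspace_scale)
      then have "\<phi> (c * x) \<in> ideal_gen (\<Union>\<K>)"
        using I by (auto intro: R.span_base)
      then show ?case using step by (simp add: \<phi>.add R.span_add)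
    qed
    then show ?thesis by (auto simp: phi_ideals_def)
  qed
  have zl_Sum: "zero_locus (ideal_gen (\<Union>\<K>)) = {P \<in> Spec. \<forall>I\<in>\<K>. I \<subseteq> P}" for \<K> :: "'a set set"
  proof -
    have "ideal_gen (\<Union>\<K>) \<subseteq> P \<longleftrightarrow> \<Union>\<K> \<subseteq> P" if "P \<in> Spec" for P
    proof
      have "is_ideal P" using that by (simp add: Spec_def prime_ideal_def)
      then show "ideal_gen (\<Union>\<K>) \<subseteq> P" if "\<Union>\<K> \<subseteq> P"
        by (rule R.span_minimal[OF that])
    qed (rule subset_trans[OF R.span_superset])
    then show ?thesis by (auto simp: zero_locus_def Sup_le_iff)
  qed
  show ?thesis
    unfolding istopology_def
  proof (intro conjI allI impI)
    fix U V
    assume "\<exists>I\<in>phi_ideals \<phi>. U = Spec - zero_locus I" "\<exists>I\<in>phi_ideals \<phi>. V = Spec - zero_locus I"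
    then obtain I J where IJ: "I \<in> phi_ideals \<phi>" "J \<in> phi_ideals \<phi>"
      "U = Spec - zero_locus I" "V = Spec - zero_locus J" by blast
    then have "U \<inter> V = Spec - zero_locus (I \<inter> J)"
      by (subst zl_Int) (auto simp: phi_ideals_def)
    then show "\<exists>I\<in>phi_ideals \<phi>. U \<inter> V = Spec - zero_locus I"
      using Int IJ by blast
  next
    fix \<U> :: "'a set set set"
    assume "\<forall>U\<in>\<U>. \<exists>I\<in>phi_ideals \<phi>. U = Spec - zero_locus I"
    then obtain i where i: "\<And>U. U \<in> \<U> \<Longrightarrow> i U \<in> phi_ideals \<phi> \<and> U = Spec - zero_locus (i U)"
      by metis
    have "\<Union>\<U> = (\<Union>U\<in>\<U>. Spec - zero_locus (i U))"
      using i by auto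
    also have "\<dots> = Spec - zero_locus (ideal_gen (\<Union>(i ` \<U>)))"
      unfolding zl_Sum by (auto simp: zero_locus_def)
    finally show "\<exists>I\<in>phi_ideals \<phi>. \<Union>\<U> = Spec - zero_locus I"
      using Sum[of "i ` \<U>"] i by blast
  qed
qed

lemma openin_CZpec:
  "frob_linear q \<phi> \<Longrightarrow> openin (CZpec \<phi>) U \<longleftrightarrow> (\<exists>I\<in>phi_ideals \<phi>. U = Spec - zero_locus I)"
  unfolding CZpec_def by (simp add: topology_inverse'[OF istopology_CZpec])

lemma topspace_CZpec:
  assumes "frob_linear q \<phi>"
  shows "topspace (CZpec \<phi>) = Spec"
proof -
  interpret R: module "(*) :: 'a \<Rightarrow> 'a \<Rightarrow> 'a" by (rule module_mult)
  have "UNIV \<in> phi_ideals \<phi>" by (auto simp: phi_ideals_def R.subspace_def)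
  moreover have "Spec - zero_locus UNIV = (Spec :: 'a set set)"
    by (auto simp: zero_locus_def Spec_def prime_ideal_def)
  ultimately have "openin (CZpec \<phi>) Spec" using openin_CZpec[OF assms] by metis
  moreover have "U \<subseteq> Spec" if "openin (CZpec \<phi>) U" for U
    using that openin_CZpec[OF assms] by auto
  ultimately show ?thesis by (metis openin_subset openin_topspace subset_antisym)
qed

lemma closedin_CZpec:
  assumes "frob_linear q \<phi>"
  shows "closedin (CZpec \<phi>) C \<longleftrightarrow> (\<exists>I\<in>phi_ideals \<phi>. C = zero_locus I)"
proof -
  have "C \<subseteq> Spec \<and> Spec - C = Spec - zero_locus I \<longleftrightarrow> C = zero_locus I" for I
    by (auto simp: zero_locus_def)
  then show ?thesis
    unfolding closedin_def topspace_CZpec[OF assms] openin_CZpec[OF assms] by blast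
qed

end

theory Submission
  imports Defs
begin

text \<open>
  For a prime \<open>P\<close> the Cartier core is the largest \<open>\<phi>\<close>-ideal contained in \<open>P\<close>, and it is again prime
  (\<open>cartier_core_Spec\<close>); since \<open>\<phi>\<close> is surjective, \<open>Schpec\<close> consists of the primes that equal their own
  core. The contraction of a \<open>\<psi>\<close>-ideal is a \<open>\<phi>\<close>-ideal, so the core of \<open>Q\<close> always contracts into the core
  of \<open>Q \<inter> R\<close>. Every condition of the theorem says in its own way that this inclusion is an equality,
  and each is shown to be equivalent to the commutativity of the square.

  Continuity is related to the square by formal arguments with largest \<open>\<psi>\<close>-ideals. The other
  conditions compare primes of \<open>S\<close> over different primes of \<open>R\<close> and rest on the Cohen-Seidenberg
  theorems. Going down moves from \<open>Q\<close> to a prime over the core of \<open>Q \<inter> R\<close>, which lies in the core of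
  \<open>Q\<close> as soon as it is a \<open>\<psi>\<close>-ideal; going up places every prime over the core of \<open>P\<close> below a
  prime over \<open>P\<close>; incomparability shows that a prime with the same contraction as its core is equal
  to it. For the condition on radicals,
  going down and incomparability identify the associated primes of \<open>S/\<surd>(PS)\<close> with the fibre over \<open>P\<close>
  (\<open>Ass_radical_extend\<close>), so that this condition compares the intersections of the two fibres.

  All three Cohen-Seidenberg statements come from one fact: an element of \<open>IS\<close> is a root of a monic
  polynomial whose lower coefficients lie in \<open>I\<close> (\<open>integral_over_ideal\<close>). Going down also needs that
  over the normal ring \<open>R\<close> each element of \<open>S\<close> has a monic minimal polynomial, which divides every
  polynomial that vanishes there (\<open>minimal_polynomial\<close>). This is Gauss' lemma for
  normal domains, derived here without splitting fields: the Dedekind-Mertens lemma bounds the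
  denominators of all powers of a coefficient of a monic factor, and a noetherian normal domain
  contains every fraction whose powers have a common denominator.
\<close>

interpretation ideal: module "(*) :: 'a::comm_ring_1 \<Rightarrow> 'a \<Rightarrow> 'a"
  by (rule module_mult)

text \<open>As a rewrite rule, this fact would undo the associativity of multiplication.\<close>

declare ideal.scale_scale [simp del]

section \<open>Prime ideals and radicals\<close>

lemma SpecD:
  assumes "P \<in> Spec"
  shows "is_ideal P" "1 \<notin> P" "x * y \<in> P \<Longrightarrow> x \<in> P \<or> y \<in> P"
proof -
  show I: "is_ideal P" and "x * y \<in> P \<Longrightarrow> x \<in> P \<or> y \<in> P"
    using assms by (auto simp: Spec_def prime_ideal_def)
  show "1 \<notin> P"
  proof
    assume "1 \<in> P"
    then have "x \<in> P" for x using ideal.subspace_scale[OF I, of 1 x] by simp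
    then show False using assms by (auto simp: Spec_def prime_ideal_def)
  qed
qed

lemma SpecI:
  assumes "is_ideal P" "1 \<notin> P" "\<And>x y. x * y \<in> P \<Longrightarrow> x \<in> P \<or> y \<in> P"
  shows "P \<in> Spec"
  using assms by (auto simp: Spec_def prime_ideal_def)

lemma Spec_power:
  assumes "P \<in> Spec" "x ^ n \<in> P"
  shows "x \<in> P"
  using assms(2) by (induction n) (use SpecD(2,3)[OF assms(1)] in auto)

lemma ideal_gen_insert_elem:
  assumes "is_ideal I" "z \<in> ideal_gen (insert x I)"
  obtains i c where "i \<in> I" "z = i + c * x"
proof -
  obtain c where "z - c * x \<in> ideal_gen I"
    using assms(2) ideal.span_insert by blast
  then have "z - c * x \<in> I" using assms(1) by (simp add: ideal.span_eq_iff[THEN iffD2])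
  then show thesis using that[of "z - c * x" c] by simp
qed

text \<open>Maximal elements among the ideals that avoid a multiplicative set are prime: if two ideals
  properly contain such an element, both meet the set, and so does their product.\<close>

lemma ex_prime_avoiding:
  fixes I M :: "'a::comm_ring_1 set"
  assumes I: "is_ideal I" and M: "1 \<in> M" "\<And>x y. x \<in> M \<Longrightarrow> y \<in> M \<Longrightarrow> x * y \<in> M"
    and disj: "I \<inter> M = {}"
  obtains Q where "Q \<in> Spec" "I \<subseteq> Q" "Q \<inter> M = {}"
proof -
  define \<A> where "\<A> = {J. is_ideal J \<and> I \<subseteq> J \<and> J \<inter> M = {}}"
  have "\<exists>Q\<in>\<A>. \<forall>J\<in>\<A>. Q \<subseteq> J \<longrightarrow> J = Q"
  proof (rule subset_Zorn_nonempty)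
    show "\<A> \<noteq> {}" using I disj by (auto simp: \<A>_def)
    fix \<C> assume ne: "\<C> \<noteq> {}" and ch: "subset.chain \<A> \<C>"
    have sub: "is_ideal J \<and> I \<subseteq> J \<and> J \<inter> M = {}" if "J \<in> \<C>" for J
      using that ch by (auto simp: subset.chain_def \<A>_def)
    have "is_ideal (\<Union>\<C>)"
    proof (rule ideal.subspaceI)
      show "0 \<in> \<Union>\<C>" using ne sub ideal.subspace_0 by blast
    next
      fix x y assume "x \<in> \<Union>\<C>" "y \<in> \<Union>\<C>"
      then obtain J K where JK: "J \<in> \<C>" "K \<in> \<C>" "x \<in> J" "y \<in> K" by blast
      then have "J \<subseteq> K \<or> K \<subseteq> J" using ch by (auto simp: subset.chain_def)
      then show "x + y \<in> \<Union>\<C>"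
        using JK sub ideal.subspace_add by (meson UnionI subsetD)
    next
      fix c x assume "x \<in> \<Union>\<C>"
      then show "c * x \<in> \<Union>\<C>" using sub ideal.subspace_scale by blast
    qed
    then show "\<Union>\<C> \<in> \<A>" using ne sub unfolding \<A>_def by blast
  qed
  then obtain Q where Q: "is_ideal Q" "I \<subseteq> Q" "Q \<inter> M = {}"
    and max: "\<And>J. is_ideal J \<Longrightarrow> J \<inter> M = {} \<Longrightarrow> Q \<subseteq> J \<Longrightarrow> J = Q"
    unfolding \<A>_def by (smt (verit) mem_Collect_eq subset_trans)
  have meets: "\<exists>i\<in>Q. \<exists>c. i + c * x \<in> M" if "x \<notin> Q" for x
  proof -
    have "Q \<subseteq> ideal_gen (insert x Q)" "x \<in> ideal_gen (insert x Q)"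
      by (auto intro: ideal.span_base)
    then have "ideal_gen (insert x Q) \<inter> M \<noteq> {}"
      using max[OF ideal.subspace_span, of "insert x Q"] that by metis
    then obtain z where "z \<in> M" "z \<in> ideal_gen (insert x Q)" by blast
    then show ?thesis using ideal_gen_insert_elem[OF Q(1)] by metis
  qed
  have "Q \<in> Spec"
  proof (rule SpecI)
    fix x y assume xy: "x * y \<in> Q"
    show "x \<in> Q \<or> y \<in> Q"
    proof (rule ccontr)
      assume "\<not> (x \<in> Q \<or> y \<in> Q)"
      then obtain i c j d where ij: "i \<in> Q" "i + c * x \<in> M" "j \<in> Q" "j + d * y \<in> M"
        using meets by metis
      have "(i + c * x) * (j + d * y) = (j + d * y) * i + (c * x) * j + (c * d) * (x * y)"
        by (simp add: algebra_simps)
      also have "\<dots> \<in> Q"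
        by (intro ideal.subspace_add[OF Q(1)])
          (rule ideal.subspace_scale[OF Q(1)], fact)+
      finally show False using M(2)[OF ij(2,4)] Q(3) by blast
    qed
  qed (use Q M(1) in blast)+
  then show thesis using that Q by blast
qed

lemma radical_eq_Inter_primes:
  assumes "is_ideal I"
  shows "radical I = \<Inter>(zero_locus I)"
proof
  show "radical I \<subseteq> \<Inter>(zero_locus I)"
    by (auto simp: radical_def zero_locus_def intro: Spec_power)
  show "\<Inter>(zero_locus I) \<subseteq> radical I"
  proof (rule subsetI, rule ccontr)
    fix x assume x: "x \<in> \<Inter>(zero_locus I)" "x \<notin> radical I"
    obtain Q where "Q \<in> Spec" "I \<subseteq> Q" "Q \<inter> range (\<lambda>n. x ^ n) = {}"
    proof (rule ex_prime_avoiding[OF assms, of "range (\<lambda>n. x ^ n)"])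
      show "1 \<in> range (\<lambda>n. x ^ n)" by (rule range_eqI[of _ _ 0]) simp
      show "a * b \<in> range (\<lambda>n. x ^ n)"
        if "a \<in> range (\<lambda>n. x ^ n)" "b \<in> range (\<lambda>n. x ^ n)" for a b
        using that by (auto simp flip: power_add)
    qed (use x in \<open>auto simp: radical_def\<close>)
    then show False
      using x(1) rangeI[of "\<lambda>n. x ^ n" 1] by (auto simp: zero_locus_def)
  qed
qed

lemma is_ideal_radical:
  assumes "is_ideal I"
  shows "is_ideal (radical I)"
  unfolding radical_eq_Inter_primes[OF assms]
  by (rule ideal.subspace_Inter) (auto simp: zero_locus_def SpecD)

text \<open>Locally at a minimal prime \<open>Q\<close> of \<open>I\<close>, every element of \<open>Q\<close> is nilpotent modulo \<open>I\<close>, hence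
  multiplied into the radical by some element outside \<open>Q\<close>. As \<open>Q\<close> is finitely generated, one such
  multiplier serves all of \<open>Q\<close>, and its annihilator is \<open>Q\<close>.\<close>

lemma minimal_prime_in_Ass:
  fixes I Q :: "'a::comm_ring_1 set"
  assumes noeth: "noetherian TYPE('a)" and I: "is_ideal I" and Q: "Q \<in> Spec" "I \<subseteq> Q"
    and min: "\<And>Q'. Q' \<in> Spec \<Longrightarrow> I \<subseteq> Q' \<Longrightarrow> Q' \<subseteq> Q \<Longrightarrow> Q' = Q"
  shows "Q \<in> Ass_quotient (radical I)"
proof -
  note Qi = SpecD[OF Q(1)] and rad = is_ideal_radical[OF I]
  have ex: "\<exists>x. x \<notin> Q \<and> a * x \<in> radical I" if a: "a \<in> Q" for a
  proof (rule ccontr)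
    assume neg: "\<not> ?thesis"
    define M where "M = {a ^ n * x | n x. x \<notin> Q}"
    obtain Q' where Q': "Q' \<in> Spec" "I \<subseteq> Q'" "Q' \<inter> M = {}"
    proof (rule ex_prime_avoiding[OF I, of M])
      show "1 \<in> M" using Qi(2) unfolding M_def by (auto intro: exI[of _ 0])
      show "u * v \<in> M" if uv: "u \<in> M" "v \<in> M" for u v
      proof -
        obtain n x m y where nm: "u = a ^ n * x" "v = a ^ m * y" "x \<notin> Q" "y \<notin> Q"
          using uv by (auto simp: M_def)
        then have "u * v = a ^ (n + m) * (x * y)" "x * y \<notin> Q"
          using Qi(3) by (auto simp: power_add algebra_simps)
        then show ?thesis unfolding M_def by blast
      qed
      have "a ^ n * x \<notin> I" if "x \<notin> Q" for n x
      proof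
        assume "a ^ n * x \<in> I"
        then have "(a * x ^ n) * (a ^ n * x) \<in> I" by (rule ideal.subspace_scale[OF I])
        then have "(a * x) ^ Suc n \<in> I" by (simp add: power_mult_distrib algebra_simps)
        then have "a * x \<in> radical I" unfolding radical_def by blast
        then show False using neg that by blast
      qed
      then show "I \<inter> M = {}" by (auto simp: M_def)
    qed
    have "Q' \<subseteq> Q"
    proof
      fix x assume "x \<in> Q'"
      then have "a ^ 0 * x \<notin> M" using Q'(3) by auto
      then show "x \<in> Q" unfolding M_def by blast
    qed
    then have "a \<in> Q'" using min Q' a by blast
    moreover have "a ^ 1 * 1 \<in> M" using Qi(2) unfolding M_def by blast
    ultimately show False using Q'(3) by auto
  qed
  then obtain x where x: "\<And>a. a \<in> Q \<Longrightarrow> x a \<notin> Q \<and> a * x a \<in> radical I" by metis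
  obtain B where B: "finite B" "ideal_gen B = Q"
    using noeth Qi(1) by (auto simp: noetherian_def)
  have BQ: "B \<subseteq> Q" using B(2) ideal.span_superset by blast
  define y where "y = (\<Prod>b\<in>B. x b)"
  have "(\<Prod>b\<in>C. x b) \<notin> Q" if "C \<subseteq> B" for C
    using finite_subset[OF that B(1)] that
    by (induction C rule: finite_induct) (use Qi(2,3) x BQ in auto)
  then have yQ: "y \<notin> Q" by (simp add: y_def)
  have "Q = {a. a * y \<in> radical I}"
  proof
    have "b * y \<in> radical I" if "b \<in> B" for b
    proof -
      have "b * x b \<in> radical I" using x that BQ by blast
      then have "(\<Prod>c\<in>B - {b}. x c) * (b * x b) \<in> radical I"
        by (rule ideal.subspace_scale[OF rad])
      also have "(\<Prod>c\<in>B - {b}. x c) * (b * x b) = b * y"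
        unfolding y_def prod.remove[OF B(1) that] by (simp add: mult_ac)
      finally show ?thesis .
    qed
    moreover have "is_ideal {a. a * y \<in> radical I}"
      using rad by (auto simp: ideal.subspace_def algebra_simps)
    ultimately show "Q \<subseteq> {a. a * y \<in> radical I}"
      using ideal.span_minimal[of B "{a. a * y \<in> radical I}", unfolded B(2)] by blast
    have "radical I \<subseteq> Q"
      unfolding radical_eq_Inter_primes[OF I]
      by (rule Inter_lower) (simp add: zero_locus_def Q)
    then show "{a. a * y \<in> radical I} \<subseteq> Q" using Qi(3)[of _ y] yQ by auto
  qed
  then show ?thesis using Q(1) unfolding Ass_quotient_def by blast
qed

section \<open>Integral equations\<close>

text \<open>A polynomial satisfies the first predicate if it may occur as the part below the leading term of
  a monic polynomial of degree \<open>n\<close> whose other coefficients lie in \<open>I\<close>. The degree \<open>n\<close> is carried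
  along because the products formed below must keep the leading term separate.\<close>

definition lower_terms :: "'a::comm_ring_1 set \<Rightarrow> nat \<Rightarrow> 'a poly \<Rightarrow> bool" where
  "lower_terms I n F \<longleftrightarrow> (\<forall>i. coeff F i \<in> I \<and> (n \<le> i \<longrightarrow> coeff F i = 0))"

definition monic_over :: "'a::comm_ring_1 set \<Rightarrow> nat \<Rightarrow> 'a poly \<Rightarrow> bool" where
  "monic_over I n F \<longleftrightarrow> lower_terms I n (F - monom 1 n)"

lemma lower_terms_add: "is_ideal I \<Longrightarrow> lower_terms I n F \<Longrightarrow> lower_terms I n G \<Longrightarrow> lower_terms I n (F + G)"
  by (auto simp: lower_terms_def ideal.subspace_add)

lemma lower_terms_diff: "is_ideal I \<Longrightarrow> lower_terms I n F \<Longrightarrow> lower_terms I n G \<Longrightarrow> lower_terms I n (F - G)"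
  by (auto simp: lower_terms_def ideal.subspace_diff)

lemma lower_terms_mult:
  assumes I: "is_ideal I" and "lower_terms I n F" "lower_terms I m G"
  shows "lower_terms I (n + m) (F * G)"
  unfolding lower_terms_def
proof (intro allI conjI impI)
  show "coeff (F * G) i \<in> I" for i
    using assms unfolding coeff_mult lower_terms_def
    by (intro ideal.subspace_sum) (auto intro: ideal.subspace_scale)
  show "coeff (F * G) i = 0" if "n + m \<le> i" for i
    unfolding coeff_mult
  proof (rule sum.neutral, rule ballI)
    fix j assume "j \<in> {..i}"
    then have "n \<le> j \<or> m \<le> i - j" using that by auto
    then show "coeff F j * coeff G (i - j) = 0" using assms by (auto simp: lower_terms_def)
  qed
qed

lemma lower_terms_monom_mult:
  assumes I: "is_ideal I" and "lower_terms I m G"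
  shows "lower_terms I (n + m) (monom 1 n * G)"
  using assms by (auto simp: lower_terms_def coeff_monom_mult ideal.subspace_0)

lemma monic_over_mult_lower_terms:
  assumes I: "is_ideal I" and F: "monic_over I n F" and G: "lower_terms I m G"
  shows "lower_terms I (n + m) (F * G)"
  using lower_terms_add[OF I lower_terms_mult[OF I F[unfolded monic_over_def] G] lower_terms_monom_mult[OF I G]]
  by (simp add: algebra_simps)

lemma monic_over_mult:
  assumes I: "is_ideal I" and F: "monic_over I n F" and G: "monic_over I m G"
  shows "monic_over I (n + m) (F * G)"
  using lower_terms_add[OF I monic_over_mult_lower_terms[OF I F G[unfolded monic_over_def]]
      lower_terms_monom_mult[OF I F[unfolded monic_over_def], of m, unfolded add.commute[of m n]]]
  by (simp add: monic_over_def algebra_simps mult_monom)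

lemma monic_over_diff:
  "is_ideal I \<Longrightarrow> monic_over I n F \<Longrightarrow> lower_terms I n G \<Longrightarrow> monic_over I n (F - G)"
  using lower_terms_diff[of I n "F - monom 1 n" G] by (simp add: monic_over_def algebra_simps)

lemma monic_overD:
  assumes "monic_over I n F"
  shows "coeff F n = 1" "i < n \<Longrightarrow> coeff F i \<in> I" "n < i \<Longrightarrow> coeff F i = 0" "degree F = n"
proof -
  have *: "coeff (F - monom 1 n) i \<in> I" "n \<le> i \<Longrightarrow> coeff (F - monom 1 n) i = 0" for i
    using assms unfolding monic_over_def lower_terms_def by blast+
  show 1: "coeff F n = 1" using *(2)[of n] by simp
  show 2: "n < i \<Longrightarrow> coeff F i = 0" for i using *(2)[of i] by auto
  show "i < n \<Longrightarrow> coeff F i \<in> I" using *(1)[of i] by simp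
  show "degree F = n"
    by (rule antisym[OF degree_le le_degree]) (use 1 2 in auto)
qed

locale ring_ext =
  fixes \<theta> :: "'r::comm_ring_1 \<Rightarrow> 's::comm_ring_1"
  assumes finite_extension: "finite_extension \<theta>"
begin

lemma inj: "inj \<theta>" and hom_1: "\<theta> 1 = 1" and hom_add: "\<theta> (x + y) = \<theta> x + \<theta> y"
  and hom_mult: "\<theta> (x * y) = \<theta> x * \<theta> y"
  using finite_extension by (auto simp: finite_extension_def ring_embedding_def)

lemma hom_0: "\<theta> 0 = 0"
  using hom_add[of 0 0] by simp

lemma hom_eq_0_iff: "\<theta> x = 0 \<longleftrightarrow> x = 0"
  using inj_eq[OF inj, of x 0] by (simp add: hom_0)

lemma hom_power: "\<theta> (x ^ n) = \<theta> x ^ n"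
  by (induction n) (simp_all add: hom_1 hom_mult)

text \<open>This evaluation makes \<open>S\<close> a module over \<open>R[X]\<close>, with the variable acting as \<open>t\<close>.\<close>

definition ev :: "'s \<Rightarrow> 'r poly \<Rightarrow> 's" where
  "ev t F = poly (map_poly \<theta> F) t"

lemma ev_0: "ev t 0 = 0"
  by (simp add: ev_def)

lemma ev_pCons: "ev t (pCons a F) = \<theta> a + t * ev t F"
  by (simp add: ev_def map_poly_pCons hom_0)

lemma ev_add: "ev t (F + G) = ev t F + ev t G"
proof (induction F arbitrary: G)
  case (pCons a F)
  then show ?case by (cases G) (simp add: ev_pCons hom_add algebra_simps)
qed (simp add: ev_0)

lemma ev_smult: "ev t (smult a F) = \<theta> a * ev t F"
  by (induction F) (simp_all add: ev_0 ev_pCons hom_mult algebra_simps)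

lemma ev_mult: "ev t (F * G) = ev t F * ev t G"
  by (induction F) (simp_all add: ev_0 ev_pCons hom_0 ev_add ev_smult algebra_simps)

lemma ev_diff: "ev t (F - G) = ev t F - ev t G"
  using ev_add[of t "F - G" G] by simp

lemma ev_hom: "ev (\<theta> x) F = \<theta> (poly F x)"
  by (induction F) (simp_all add: ev_0 ev_pCons hom_0 hom_add hom_mult)

lemma ev_monom: "ev t (monom a n) = \<theta> a * t ^ n"
  by (induction n) (simp_all add: ev_0 ev_pCons monom_0 monom_Suc hom_0)

lemma ev_altdef: "ev t F = (\<Sum>i\<le>degree F. \<theta> (coeff F i) * t ^ i)"
proof -
  have "ev t (\<Sum>i\<in>A. monom (coeff F i) i) = (\<Sum>i\<in>A. \<theta> (coeff F i) * t ^ i)" for A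
    by (induction A rule: infinite_finite_induct) (simp_all add: ev_0 ev_add ev_monom)
  then show ?thesis by (metis poly_as_sum_of_monoms)
qed

text \<open>This is the determinant trick, carried out by eliminating one generator at a time: a monic
  polynomial that sends the generators into their \<open>I\<close>-combinations of smaller degree can be
  multiplied by another one that removes a chosen generator from all these combinations.\<close>

lemma monic_annihilator:
  assumes I: "is_ideal I" and "finite B" and "monic_over I n F"
    and "\<And>b. b \<in> B \<Longrightarrow> \<exists>h. (\<forall>c\<in>B. lower_terms I n (h c)) \<and> ev t F * b = (\<Sum>c\<in>B. ev t (h c) * c)"
  shows "\<exists>m G. monic_over I m G \<and> (\<forall>b\<in>B. ev t G * b = 0)"
  using assms(2-4)
proof (induction B arbitrary: n F rule: finite_induct)
  case empty
  then show ?case by blast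
next
  case (insert b B)
  obtain g where g: "\<And>c d. c \<in> insert b B \<Longrightarrow> d \<in> insert b B \<Longrightarrow> lower_terms I n (g c d)"
    "\<And>c. c \<in> insert b B \<Longrightarrow> ev t F * c = (\<Sum>d\<in>insert b B. ev t (g c d) * d)"
    using insert.prems(2) by metis
  \<comment> \<open>\<open>A\<close> sends the chosen generator into the span of the others, so that multiplying \<open>F\<close> by \<open>A\<close>
    eliminates this generator from the images of the others.\<close>
  define A where "A = F - g b b"
  have A: "monic_over I n A"
    unfolding A_def using insert.prems(1) g(1) I by (intro monic_over_diff) auto
  have Ab: "ev t A * b = (\<Sum>d\<in>B. ev t (g b d) * d)"
    using g(2)[of b] insert.hyps by (simp add: A_def ev_diff algebra_simps)
  have "\<exists>m G. monic_over I m G \<and> (\<forall>c\<in>B. ev t G * c = 0)"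
  proof (rule insert.IH)
    show "monic_over I (n + n) (A * F)" using A insert.prems(1) by (rule monic_over_mult[OF I])
    fix c assume c: "c \<in> B"
    define h where "h d = g c b * g b d + A * g c d" for d
    have "lower_terms I (n + n) (h d)" if "d \<in> B" for d
      unfolding h_def using g(1) that c A I
      by (intro lower_terms_add lower_terms_mult monic_over_mult_lower_terms) auto
    moreover have "ev t (A * F) * c = (\<Sum>d\<in>B. ev t (h d) * d)"
    proof -
      have "ev t (A * F) * c = ev t A * (\<Sum>d\<in>insert b B. ev t (g c d) * d)"
        using g(2)[of c] c by (simp add: ev_mult mult.assoc)
      also have "\<dots> = ev t (g c b) * (ev t A * b) + (\<Sum>d\<in>B. ev t A * ev t (g c d) * d)"
        using insert.hyps by (simp add: algebra_simps sum_distrib_left)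
      also have "\<dots> = (\<Sum>d\<in>B. ev t (h d) * d)"
        unfolding Ab h_def sum_distrib_left
        by (simp add: ev_add ev_mult algebra_simps flip: sum.distrib)
      finally show ?thesis .
    qed
    ultimately show "\<exists>h. (\<forall>d\<in>B. lower_terms I (n + n) (h d))
        \<and> ev t (A * F) * c = (\<Sum>d\<in>B. ev t (h d) * d)" by blast
  qed
  then obtain m G where G: "monic_over I m G" "\<And>c. c \<in> B \<Longrightarrow> ev t G * c = 0" by blast
  have "ev t (G * A) * c = 0" if "c \<in> insert b B" for c
  proof (cases "c = b")
    case True
    have "ev t (G * A) * b = ev t G * (ev t A * b)" by (simp add: ev_mult mult.assoc)
    also have "\<dots> = (\<Sum>d\<in>B. ev t (g b d) * (ev t G * d))"
      unfolding Ab by (simp add: sum_distrib_left algebra_simps)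
    also have "\<dots> = 0" using G(2) by simp
    finally show ?thesis using True by simp
  next
    case False
    then have "ev t G * c = 0" using that G(2) by simp
    then show ?thesis by (metis ev_mult mult.commute mult.left_commute mult_zero_right)
  qed
  then show ?case using monic_over_mult[OF I G(1) A] by blast
qed

lemma is_ideal_extend: "is_ideal (extend \<theta> I)"
  by (simp add: extend_def)

lemma hom_in_extend: "x \<in> I \<Longrightarrow> \<theta> x \<in> extend \<theta> I"
  by (auto simp: extend_def intro: ideal.span_base)

lemma extend_subset_iff:
  assumes "is_ideal J"
  shows "extend \<theta> I \<subseteq> J \<longleftrightarrow> I \<subseteq> contract \<theta> J"
  using ideal.span_minimal[OF _ assms, of "\<theta> ` I"] hom_in_extend
  by (auto simp: extend_def contract_def)

lemma is_ideal_contract: "is_ideal J \<Longrightarrow> is_ideal (contract \<theta> J)"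
  by (auto simp: contract_def ideal.subspace_def hom_0 hom_add hom_mult)

lemma contract_Spec: "Q \<in> Spec \<Longrightarrow> contract \<theta> Q \<in> Spec"
  using is_ideal_contract[OF SpecD(1)] SpecD(2,3)[of Q]
  by (intro SpecI) (auto simp: contract_def hom_1 hom_mult)

text \<open>Multiplication by an element of \<open>IS\<close> sends the generators of \<open>S\<close> to \<open>I\<close>-combinations of them,
  so \<open>monic_annihilator\<close> applies to the variable, and an element that annihilates all generators
  annihilates \<open>1\<close>. For \<open>I = R\<close> this is the integrality of \<open>S\<close> over \<open>R\<close>.\<close>

lemma integral_over_ideal:
  assumes I: "is_ideal I" and t: "t \<in> extend \<theta> I"
  obtains n F where "monic_over I n F" "ev t F = 0"
proof -
  have S: "module (\<lambda>r s. \<theta> r * s)"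
    by unfold_locales (simp_all add: hom_add hom_mult hom_1 algebra_simps)
  obtain B where B: "finite B" "module.span (\<lambda>r s. \<theta> r * s) B = UNIV"
    using finite_extension by (auto simp: finite_extension_def)
  have "UNIV = range (\<lambda>h. \<Sum>b\<in>B. \<theta> (h b) * b)"
    using module.span_finite[OF S B(1)] B(2) by simp
  then have comb: "\<exists>h. s = (\<Sum>b\<in>B. \<theta> (h b) * b)" for s by blast
  define J where "J = {\<Sum>b\<in>B. \<theta> (h b) * b | h. \<forall>b\<in>B. h b \<in> I}"
  have "is_ideal J"
  proof (rule ideal.subspaceI)
    show "0 \<in> J" unfolding J_def
      by (rule CollectI, rule exI[of _ "\<lambda>_. 0"]) (simp add: hom_0 I ideal.subspace_0)
  next
    fix x y assume "x \<in> J" "y \<in> J"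
    then obtain h k where hk: "\<forall>b\<in>B. h b \<in> I" "\<forall>b\<in>B. k b \<in> I"
      "x = (\<Sum>b\<in>B. \<theta> (h b) * b)" "y = (\<Sum>b\<in>B. \<theta> (k b) * b)" unfolding J_def by blast
    then have "x + y = (\<Sum>b\<in>B. \<theta> (h b + k b) * b)"
      by (simp add: hom_add algebra_simps sum.distrib)
    then show "x + y \<in> J" using hk I unfolding J_def
      by (intro CollectI exI[of _ "\<lambda>b. h b + k b"]) (auto intro: ideal.subspace_add)
  next
    fix s x assume "x \<in> J"
    then obtain h where h: "\<forall>b\<in>B. h b \<in> I" "x = (\<Sum>b\<in>B. \<theta> (h b) * b)" unfolding J_def by blast
    obtain k where k: "\<And>b. s * b = (\<Sum>c\<in>B. \<theta> (k b c) * c)" using comb by metis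
    have "s * x = (\<Sum>b\<in>B. \<theta> (h b) * (s * b))"
      unfolding h(2) sum_distrib_left by (simp add: algebra_simps)
    also have "\<dots> = (\<Sum>b\<in>B. \<Sum>c\<in>B. \<theta> (k b c * h b) * c)"
      unfolding k by (simp add: sum_distrib_left hom_mult algebra_simps)
    also have "\<dots> = (\<Sum>c\<in>B. \<Sum>b\<in>B. \<theta> (k b c * h b) * c)" by (rule sum.swap)
    also have "\<dots> = (\<Sum>c\<in>B. \<theta> (\<Sum>b\<in>B. k b c * h b) * c)"
    proof -
      have "\<theta> (sum f A) = (\<Sum>a\<in>A. \<theta> (f a))" for f and A :: "'s set"
        by (induction A rule: infinite_finite_induct) (simp_all add: hom_0 hom_add)
      then show ?thesis by (simp add: sum_distrib_right)
    qed
    finally show "s * x \<in> J" using h(1) I unfolding J_def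
      by (intro CollectI exI[of _ "\<lambda>c. \<Sum>b\<in>B. k b c * h b"])
        (auto intro!: ideal.subspace_sum ideal.subspace_scale)
  qed
  moreover have "\<theta> ` I \<subseteq> J"
  proof (rule image_subsetI)
    fix x assume x: "x \<in> I"
    obtain h where "1 = (\<Sum>b\<in>B. \<theta> (h b) * b)" using comb by metis
    then have "\<theta> x = \<theta> x * (\<Sum>b\<in>B. \<theta> (h b) * b)" by simp
    also have "\<dots> = (\<Sum>b\<in>B. \<theta> (h b * x) * b)"
      by (simp add: hom_mult sum_distrib_left mult_ac)
    finally have "\<theta> x = (\<Sum>b\<in>B. \<theta> (h b * x) * b)" .
    then show "\<theta> x \<in> J" using x I unfolding J_def
      by (intro CollectI exI[of _ "\<lambda>b. h b * x"]) (auto intro: ideal.subspace_scale)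
  qed
  ultimately have sub: "extend \<theta> I \<subseteq> J" unfolding extend_def by (intro ideal.span_minimal)
  have "\<exists>m G. monic_over I m G \<and> (\<forall>b\<in>B. ev t G * b = 0)"
  proof (rule monic_annihilator[OF I B(1)])
    show "monic_over I 1 (monom 1 1)"
      using I by (simp add: monic_over_def lower_terms_def ideal.subspace_0)
    fix b
    have "b * t \<in> J" using sub t is_ideal_extend ideal.subspace_scale by blast
    then obtain h where h: "\<forall>b\<in>B. h b \<in> I" "b * t = (\<Sum>b\<in>B. \<theta> (h b) * b)"
      unfolding J_def by blast
    show "\<exists>h. (\<forall>c\<in>B. lower_terms I 1 (h c)) \<and> ev t (monom 1 1) * b = (\<Sum>c\<in>B. ev t (h c) * c)"
      using h I
      by (intro exI[of _ "\<lambda>c. [:h c:]"])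
        (auto simp: lower_terms_def ev_monom ev_pCons ev_0 hom_1 mult.commute coeff_pCons
          ideal.subspace_0 split: nat.split)
  qed
  then obtain m G where G: "monic_over I m G" "\<forall>b\<in>B. ev t G * b = 0" by blast
  obtain h where "1 = (\<Sum>b\<in>B. \<theta> (h b) * b)" using comb by metis
  then have "ev t G = ev t G * (\<Sum>b\<in>B. \<theta> (h b) * b)" by simp
  also have "\<dots> = (\<Sum>b\<in>B. \<theta> (h b) * (ev t G * b))"
    by (simp add: sum_distrib_left mult_ac)
  finally have "ev t G = 0" using G(2) by simp
  then show thesis using that G(1) by blast
qed

lemma poly_monic_over_prime:
  assumes P: "P \<in> Spec" and F: "monic_over P n F" and "poly F x \<in> P"
  shows "x \<in> P"
proof -
  have "(\<Sum>i<n. x ^ i * coeff F i) \<in> P"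
    using monic_overD(2)[OF F] SpecD(1)[OF P]
    by (intro ideal.subspace_sum) (auto intro: ideal.subspace_scale)
  moreover have "poly F x = (\<Sum>i<n. x ^ i * coeff F i) + x ^ n"
    using monic_overD[OF F] by (simp add: poly_altdef mult.commute flip: lessThan_Suc_atMost)
  ultimately have "x ^ n \<in> P"
    using assms(3) ideal.subspace_diff[OF SpecD(1)[OF P]] by fastforce
  then show ?thesis by (rule Spec_power[OF P])
qed

lemma ev_monic_over_extend:
  assumes F: "monic_over I n F" and "ev t F = 0"
  shows "t ^ n \<in> extend \<theta> I"
proof -
  have "(\<Sum>i<n. t ^ i * \<theta> (coeff F i)) \<in> extend \<theta> I"
    using monic_overD(2)[OF F]
    by (intro ideal.subspace_sum is_ideal_extend ideal.subspace_scale[OF is_ideal_extend])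
      (auto intro: hom_in_extend)
  moreover have "ev t F = (\<Sum>i<n. t ^ i * \<theta> (coeff F i)) + t ^ n"
    using monic_overD[OF F] by (simp add: ev_altdef hom_1 mult.commute flip: lessThan_Suc_atMost)
  ultimately show ?thesis
    using assms(2) ideal.subspace_neg[OF is_ideal_extend]
    by (metis add_eq_0_iff)
qed

section \<open>Incomparability and going up\<close>

text \<open>An element of \<open>Q\<close> outside \<open>Q'\<close> is a root of a monic polynomial. Modulo \<open>Q'\<close> the constant term
  of such a polynomial vanishes, as it lies in \<open>Q\<close> and in \<open>R\<close>, so that a factor \<open>t\<close> can be cancelled
  until the polynomial \<open>1\<close> is left.\<close>

lemma incomparable:
  assumes Q: "Q \<in> Spec" "Q' \<in> Spec" "Q' \<subseteq> Q" "contract \<theta> Q' = contract \<theta> Q"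
  shows "Q' = Q"
proof (rule antisym[OF Q(3)], rule subsetI, rule ccontr)
  fix t assume t: "t \<in> Q" "t \<notin> Q'"
  have "\<not> (lead_coeff F = 1 \<and> ev t F \<in> Q')" for F
  proof (induction F)
    case 0
    have "(0::'r) \<noteq> 1" using hom_0 hom_1 SpecD(1,2)[OF Q(1)] ideal.subspace_0 by metis
    then show ?case by simp
  next
    case (pCons a F)
    show ?case
    proof
      assume F: "lead_coeff (pCons a F) = 1 \<and> ev t (pCons a F) \<in> Q'"
      then have "\<theta> a + t * ev t F \<in> Q" using Q(3) by (auto simp: ev_pCons)
      moreover have "ev t F * t \<in> Q" using t SpecD(1)[OF Q(1)] by (intro ideal.subspace_scale)
      ultimately have "\<theta> a \<in> Q"
        using ideal.subspace_diff[OF SpecD(1)[OF Q(1)]] by (fastforce simp: mult.commute)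
      then have aQ': "\<theta> a \<in> Q'" using Q(4) by (auto simp: contract_def)
      have "t * ev t F \<in> Q'"
        using F ideal.subspace_diff[OF SpecD(1)[OF Q(2)] _ aQ', of "\<theta> a + t * ev t F"]
        by (simp add: ev_pCons)
      then have "ev t F \<in> Q'" using t SpecD(3)[OF Q(2)] by blast
      moreover have "lead_coeff F = 1"
      proof (cases "F = 0")
        case True
        then show ?thesis using F aQ' SpecD(2)[OF Q(2)] by (simp add: hom_1)
      qed (use F in simp)
      ultimately show False using pCons by blast
    qed
  qed
  moreover obtain n F where "monic_over UNIV n F" "ev t F = 0"
  proof (rule integral_over_ideal)
    show "t \<in> extend \<theta> UNIV"
      using ideal.subspace_scale[OF is_ideal_extend hom_in_extend, of 1 UNIV t]
      by (simp add: hom_1)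
  qed simp_all
  ultimately show False
    using monic_overD(1,4) ideal.subspace_0[OF SpecD(1)[OF Q(2)]] by fastforce
qed

text \<open>It suffices that \<open>Q' + PS\<close> contains no element of \<open>R\<close> outside \<open>P\<close>. Modulo \<open>Q'\<close> such an element
  would be integral over the ideal \<open>P\<close>, which forces it into \<open>P\<close>.\<close>

lemma going_up:
  assumes Q': "Q' \<in> Spec" and P: "P \<in> Spec" "contract \<theta> Q' \<subseteq> P"
  obtains Q where "Q \<in> Spec" "Q' \<subseteq> Q" "contract \<theta> Q = P"
proof -
  define J where "J = {x + y | x y. x \<in> Q' \<and> y \<in> extend \<theta> P}"
  have J: "is_ideal J"
  proof (rule ideal.subspaceI)
    show "0 \<in> J" unfolding J_def
      using ideal.subspace_0[OF SpecD(1)[OF Q']] ideal.subspace_0[OF is_ideal_extend] by force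
  next
    fix a b assume "a \<in> J" "b \<in> J"
    then obtain x y u v where *: "a = x + y" "b = u + v"
      "x \<in> Q'" "u \<in> Q'" "y \<in> extend \<theta> P" "v \<in> extend \<theta> P" unfolding J_def by blast
    have "a + b = (x + u) + (y + v)" using * by simp
    then show "a + b \<in> J" unfolding J_def
      using * ideal.subspace_add[OF SpecD(1)[OF Q']] ideal.subspace_add[OF is_ideal_extend]
      by blast
  next
    fix c a assume "a \<in> J"
    then obtain x y where *: "a = x + y" "x \<in> Q'" "y \<in> extend \<theta> P" unfolding J_def by blast
    then have "c * a = c * x + c * y" by (simp add: algebra_simps)
    then show "c * a \<in> J" unfolding J_def
      using * ideal.subspace_scale[OF SpecD(1)[OF Q']] ideal.subspace_scale[OF is_ideal_extend]
      by blast
  qed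
  have "\<theta> r \<notin> J" if r: "r \<notin> P" for r
  proof
    assume "\<theta> r \<in> J"
    then obtain x y where xy: "\<theta> r = x + y" "x \<in> Q'" "y \<in> extend \<theta> P" by (auto simp: J_def)
    obtain n F where F: "monic_over P n F" "ev y F = 0"
      using integral_over_ideal[OF SpecD(1)[OF P(1)] xy(3)] by blast
    have "ev (x + y) F - ev y F \<in> Q'"
    proof (induction F)
      case 0
      then show ?case using SpecD(1)[OF Q'] by (simp add: ev_0 ideal.subspace_0)
    next
      case (pCons a F)
      have "(x + y) * (ev (x + y) F - ev y F) + ev y F * x \<in> Q'"
        using pCons xy SpecD(1)[OF Q'] by (intro ideal.subspace_add ideal.subspace_scale)
      then show ?case by (simp add: ev_pCons algebra_simps)
    qed
    then have "\<theta> (poly F r) \<in> Q'" using F(2) by (simp add: ev_hom flip: xy(1))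
    then have "poly F r \<in> P" using P(2) by (auto simp: contract_def)
    then show False using poly_monic_over_prime[OF P(1) F(1)] r by blast
  qed
  then have "J \<inter> \<theta> ` (- P) = {}" by auto
  moreover have "1 \<in> \<theta> ` (- P)"
    using SpecD(2)[OF P(1)] hom_1 by (metis ComplI image_eqI)
  moreover have "a * b \<in> \<theta> ` (- P)" if ab: "a \<in> \<theta> ` (- P)" "b \<in> \<theta> ` (- P)" for a b
  proof -
    obtain x y where "a = \<theta> x" "b = \<theta> y" "x \<notin> P" "y \<notin> P" using ab by blast
    then show ?thesis using SpecD(3)[OF P(1)] by (metis ComplI hom_mult image_eqI)
  qed
  ultimately obtain Q where Q: "Q \<in> Spec" "J \<subseteq> Q" "Q \<inter> \<theta> ` (- P) = {}"
    using ex_prime_avoiding[OF J, of "\<theta> ` (- P)"] by metis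
  have "Q' \<subseteq> J" unfolding J_def
    using ideal.subspace_0[OF is_ideal_extend] by force
  moreover have "extend \<theta> P \<subseteq> J" unfolding J_def
    using ideal.subspace_0[OF SpecD(1)[OF Q']] by force
  moreover have "contract \<theta> Q \<subseteq> P" using Q(3) by (auto simp: contract_def)
  ultimately show thesis
    using that[OF Q(1)] Q(2) extend_subset_iff[OF SpecD(1)[OF Q(1)], of P]
    by (meson subset_antisym subset_trans)
qed

end

section \<open>Minimal polynomials over a normal domain\<close>

text \<open>These products of \<open>m\<close> coefficients generate the \<open>m\<close>-th power of the content ideal of \<open>F\<close>.\<close>

primrec coeff_prods :: "'a::comm_ring_1 poly \<Rightarrow> nat \<Rightarrow> 'a set" where
  "coeff_prods F 0 = {1}"
| "coeff_prods F (Suc m) = {coeff F i * w | i w. w \<in> coeff_prods F m}"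

declare coeff_prods.simps(2) [simp del]

lemma coeff_prods_SucI: "w \<in> coeff_prods F m \<Longrightarrow> coeff F i * w \<in> coeff_prods F (Suc m)"
  by (auto simp: coeff_prods.simps)

lemma coeff_prods_SucE:
  assumes "w \<in> coeff_prods F (Suc m)"
  obtains i v where "w = coeff F i * v" "v \<in> coeff_prods F m"
  using assms by (auto simp: coeff_prods.simps)

lemma coeff_prods_delete:
  assumes "w \<in> coeff_prods (F - monom (coeff F n) n) m"
  shows "w = 0 \<or> w \<in> coeff_prods F m"
  using assms
proof (induction m arbitrary: w)
  case (Suc m)
  from Suc.prems obtain i v where iv: "w = coeff (F - monom (coeff F n) n) i * v"
    "v \<in> coeff_prods (F - monom (coeff F n) n) m" by (rule coeff_prods_SucE)
  show ?case
  proof (cases "i = n \<or> v = 0")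
    case False
    then show ?thesis using Suc.IH[OF iv(2)] iv(1) by (auto intro: coeff_prods_SucI)
  qed (use iv(1) in auto)
qed simp

lemma coeff_prods_split:
  assumes "w \<in> coeff_prods F (Suc m)"
  shows "w \<in> coeff_prods (F - monom (coeff F n) n) (Suc m)
    \<or> (\<exists>v\<in>coeff_prods F m. w = coeff F n * v)"
  using assms
proof (induction m arbitrary: w)
  case 0
  then obtain i where w: "w = coeff F i * 1" by (auto elim: coeff_prods_SucE)
  show ?case
  proof (cases "i = n")
    case False
    then have "w = coeff (F - monom (coeff F n) n) i * 1" using w by simp
    then show ?thesis
      using coeff_prods_SucI[of 1 "F - monom (coeff F n) n" 0 i] by simp
  qed (use w in \<open>auto intro: bexI[of _ 1]\<close>)
next
  case (Suc m)
  from Suc.prems obtain i v where iv: "w = coeff F i * v" "v \<in> coeff_prods F (Suc m)"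
    by (rule coeff_prods_SucE)
  show ?case
  proof (cases "i = n")
    case True
    then show ?thesis using iv by blast
  next
    case False
    then have i: "coeff (F - monom (coeff F n) n) i = coeff F i" by simp
    from Suc.IH[OF iv(2)] show ?thesis
    proof
      assume "v \<in> coeff_prods (F - monom (coeff F n) n) (Suc m)"
      then show ?thesis using coeff_prods_SucI[of v _ "Suc m" i] iv(1) i by metis
    next
      assume "\<exists>u\<in>coeff_prods F m. v = coeff F n * u"
      then obtain u where u: "u \<in> coeff_prods F m" "v = coeff F n * u" by blast
      then have "coeff F i * u \<in> coeff_prods F (Suc m)" "w = coeff F n * (coeff F i * u)"
        using iv(1) by (simp_all add: coeff_prods_SucI mult.left_commute)
      then show ?thesis by blast
    qed
  qed
qed

text \<open>The Dedekind-Mertens lemma: in terms of content ideals, \<open>c(F)\<^sup>m\<^sup>+\<^sup>1 c(G) \<subseteq> c(F)\<^sup>m c(FG)\<close> if \<open>G\<close> has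
  degree at most \<open>m\<close>. Let \<open>a\<close> and \<open>b\<close> be the top coefficients of \<open>F\<close> and \<open>G\<close>. As \<open>a b\<close> is a
  coefficient of \<open>FG\<close>, removing the leading term of \<open>G\<close> changes \<open>a FG\<close> only by elements of
  \<open>c(F) c(FG)\<close>; induction on \<open>m\<close> then gives the products that have \<open>a\<close> as a factor. With
  these known, the leading term of \<open>F\<close> can be removed in the same way, by an inner induction on the
  degree of \<open>F\<close>. Phrasing the conclusion with an arbitrary additive subgroup \<open>N\<close> dispenses with products
  of ideals, since the subgroup can be replaced by \<open>{x. a x \<in> N}\<close> in the induction.\<close>

lemma Dedekind_Mertens:
  fixes F G :: "'a::comm_ring_1 poly"
  assumes "degree G \<le> m" and "0 \<in> N" "\<And>x y. x \<in> N \<Longrightarrow> y \<in> N \<Longrightarrow> x - y \<in> N"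
    and "\<And>w i. w \<in> coeff_prods F m \<Longrightarrow> w * coeff (F * G) i \<in> N"
    and "w \<in> coeff_prods F (Suc m)"
  shows "w * coeff G j \<in> N"
  using assms
proof (induction m arbitrary: F G N w j)
  case 0
  then obtain b where "G = [:b:]" using degree_0_id by (metis le_zero_eq)
  moreover obtain i where "w = coeff F i"
    using "0.prems"(5) by (auto elim: coeff_prods_SucE)
  ultimately show ?case
    using "0.prems"(4)[of 1 i] "0.prems"(2)
    by (cases j) (simp_all add: mult.commute)
next
  case (Suc m)
  \<comment> \<open>The products with the leading coefficient of \<open>F\<close> as a factor.\<close>
  have lead: "coeff F n * v * coeff G j \<in> N"
    if F: "\<And>i. n < i \<Longrightarrow> coeff F i = 0" and v: "v \<in> coeff_prods F (Suc m)"
      and FG: "\<And>w i. w \<in> coeff_prods F (Suc m) \<Longrightarrow> w * coeff (F * G) i \<in> N"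
    for F n v j
  proof -
    define b where "b = coeff G (Suc m)"
    define G' where "G' = G - monom b (Suc m)"
    have top: "coeff (F * G) (n + Suc m) = coeff F n * b"
    proof -
      have "coeff F i * coeff G (n + Suc m - i) = 0" if "i \<le> n + Suc m" "i \<noteq> n" for i
      proof (cases "i < n")
        case True
        then show ?thesis using Suc.prems(1) by (simp add: coeff_eq_0)
      qed (use that F in simp)
      then have "(\<Sum>i\<in>{..n + Suc m} - {n}. coeff F i * coeff G (n + Suc m - i)) = 0"
        by (intro sum.neutral) auto
      then show ?thesis
        unfolding coeff_mult b_def by (subst sum.remove[of _ n]) auto
    qed
    show ?thesis
    proof (cases "j = Suc m")
      case True
      then show ?thesis using FG[OF v, of "n + Suc m"] unfolding top b_def by (simp add: mult_ac)
    next
      case False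
      have "v * coeff G' j \<in> {x. coeff F n * x \<in> N}"
      proof (rule Suc.IH[of G' _ F])
        show "degree G' \<le> m"
          using Suc.prems(1) by (intro degree_le) (auto simp: G'_def b_def coeff_eq_0)
        show "0 \<in> {x. coeff F n * x \<in> N}" using Suc.prems(2) by simp
        show "x - y \<in> {x. coeff F n * x \<in> N}"
          if "x \<in> {x. coeff F n * x \<in> N}" "y \<in> {x. coeff F n * x \<in> N}" for x y
          using that Suc.prems(3) by (simp add: right_diff_distrib)
        show "u * coeff (F * G') i \<in> {x. coeff F n * x \<in> N}" if u: "u \<in> coeff_prods F m" for u i
        proof -
          have "coeff F n * u * coeff (F * G) i \<in> N"
            using u by (intro FG coeff_prods_SucI)
          moreover have cM: "coeff (F * monom b (Suc m)) i
              = (if Suc m \<le> i then coeff F (i - Suc m) * b else 0)"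
            unfolding mult.commute[of F "monom b (Suc m)"]
            by (simp add: coeff_monom_mult mult.commute[of b])
          have "coeff F n * u * coeff (F * monom b (Suc m)) i \<in> N"
          proof (cases "Suc m \<le> i")
            case True
            have "(coeff F (i - Suc m) * u) * coeff (F * G) (n + Suc m) \<in> N"
              using u by (intro FG coeff_prods_SucI)
            then show ?thesis
              using True unfolding top cM by (simp add: mult_ac)
          next
            case False
            then show ?thesis
              using Suc.prems(2) unfolding cM by simp
          qed
          ultimately have "coeff F n * u * coeff (F * G) i
              - coeff F n * u * coeff (F * monom b (Suc m)) i \<in> N"
            by (rule Suc.prems(3))
          then show ?thesis by (simp add: G'_def algebra_simps)
        qed
        show "v \<in> coeff_prods F (Suc m)" by (rule v)
      qed
      then show ?thesis using False by (simp add: G'_def mult_ac)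
    qed
  qed
  have "w * coeff G j \<in> N"
    if "\<And>i. n \<le> i \<Longrightarrow> coeff F i = 0"
      and "\<And>w i. w \<in> coeff_prods F (Suc m) \<Longrightarrow> w * coeff (F * G) i \<in> N"
      and "w \<in> coeff_prods F (Suc (Suc m))" for n F w
    using that
  proof (induction n arbitrary: F w)
    case 0
    then show ?case using Suc.prems(2) by (auto elim: coeff_prods_SucE)
  next
    case (Suc n)
    define F' where "F' = F - monom (coeff F n) n"
    from coeff_prods_split[OF Suc.prems(3), of n] show ?case
    proof
      assume w: "w \<in> coeff_prods (F - monom (coeff F n) n) (Suc (Suc m))"
      show ?thesis
      proof (rule Suc.IH)
        show "w \<in> coeff_prods F' (Suc (Suc m))" using w by (simp add: F'_def)
        show "coeff F' i = 0" if "n \<le> i" for i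
          using that Suc.prems(1)[of i] by (cases "i = n") (auto simp: F'_def)
        show "u * coeff (F' * G) i \<in> N" if "u \<in> coeff_prods F' (Suc m)" for u i
        proof (cases "u = 0")
          case False
          then have u: "u \<in> coeff_prods F (Suc m)"
            using coeff_prods_delete that unfolding F'_def by blast
          have "u * coeff (monom (coeff F n) n * G) i \<in> N"
          proof (cases "n \<le> i")
            case True
            have "coeff F n * u * coeff G (i - n) \<in> N"
              using Suc.prems(1,2) u by (intro lead) auto
            then show ?thesis
              using True by (simp add: coeff_monom_mult mult.assoc mult.left_commute)
          next
            case False
            then show ?thesis using \<open>0 \<in> N\<close> by (simp add: coeff_monom_mult)
          qed
          from Suc.prems(2)[OF u, of i] this
          have "u * coeff (F * G) i - u * coeff (monom (coeff F n) n * G) i \<in> N"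
            by (rule \<open>\<And>x y. x \<in> N \<Longrightarrow> y \<in> N \<Longrightarrow> x - y \<in> N\<close>)
          then show ?thesis by (simp add: F'_def algebra_simps)
        qed (use \<open>0 \<in> N\<close> in simp)
      qed
    next
      assume "\<exists>v\<in>coeff_prods F (Suc m). w = coeff F n * v"
      then show ?thesis using Suc.prems(1,2) lead by (metis Suc_le_eq)
    qed
  qed
  then show ?case
    using Suc.prems(4,5) by (metis (no_types) coeff_eq_0 Suc_le_eq)
qed

lemma ideal_gen_lessThan_image:
  fixes x :: "nat \<Rightarrow> 'a::comm_ring_1"
  assumes "z \<in> ideal_gen (x ` {..<n})"
  shows "\<exists>r. z = (\<Sum>i<n. r i * x i)"
  using assms
proof (induction n arbitrary: z)
  case (Suc n)
  have "x ` {..<Suc n} = insert (x n) (x ` {..<n})" by (auto simp: lessThan_Suc)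
  then have "z \<in> {y. \<exists>c. y - c * x n \<in> ideal_gen (x ` {..<n})}"
    using Suc.prems ideal.span_insert[of "x n" "x ` {..<n}"] by simp
  then obtain c where "z - c * x n \<in> ideal_gen (x ` {..<n})" by blast
  then obtain r where r: "z - c * x n = (\<Sum>i<n. r i * x i)" using Suc.IH by blast
  have "z = (\<Sum>i<Suc n. (if i = n then c else r i) * x i)"
    using r by (simp add: algebra_simps)
  then show ?case by (rule exI[of _ "\<lambda>i. if i = n then c else r i"])
qed simp

text \<open>The ascending chain condition for the ideals generated by the initial segments of a sequence.\<close>

lemma noetherian_sequence:
  fixes x :: "nat \<Rightarrow> 'a::comm_ring_1"
  assumes "noetherian TYPE('a)"
  obtains n r where "x n = (\<Sum>i<n. r i * x i)"
proof -
  obtain B where B: "finite B" "ideal_gen B = ideal_gen (range x)"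
    using assms ideal.subspace_span unfolding noetherian_def by blast
  have mono: "ideal_gen (x ` {..<n}) \<subseteq> ideal_gen (x ` {..<m})" if "n \<le> m" for n m
    using that by (intro ideal.span_mono image_mono) auto
  have "\<exists>n. b \<in> ideal_gen (x ` {..<n})" if b: "b \<in> ideal_gen (range x)" for b
    using b
  proof (induction rule: ideal.span_induct_alt)
    case base
    then show ?case using ideal.span_zero by blast
  next
    case (step c u v)
    then obtain i n where in': "u = x i" "v \<in> ideal_gen (x ` {..<n})" by blast
    define m where "m = max n (Suc i)"
    have "v \<in> ideal_gen (x ` {..<m})" using mono[of n m] in'(2) by (auto simp: m_def)
    moreover have "u \<in> ideal_gen (x ` {..<m})"
      unfolding in'(1) by (intro ideal.span_base imageI) (simp add: m_def)
    ultimately show ?case by (meson ideal.span_add ideal.span_scale)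
  qed
  then obtain n where n: "\<And>b. b \<in> B \<Longrightarrow> b \<in> ideal_gen (x ` {..<n b})"
    using B(2) ideal.span_base by metis
  define m where "m = Max (insert 0 (n ` B))"
  have "n b \<le> m" if "b \<in> B" for b using that B(1) by (simp add: m_def)
  then have "B \<subseteq> ideal_gen (x ` {..<m})" using n mono by blast
  then have "ideal_gen (range x) \<subseteq> ideal_gen (x ` {..<m})"
    unfolding B(2)[symmetric] by (intro ideal.span_minimal) auto
  then have "x m \<in> ideal_gen (x ` {..<m})" using ideal.span_base[of "x m" "range x"] by blast
  then show thesis using ideal_gen_lessThan_image that by blast
qed

text \<open>Noetherian normal domains are completely integrally closed: the quotients \<open>d (c/a)\<^sup>j\<close> generate a
  finitely generated ideal, so one of them is a combination of its predecessors, and this relation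
  is an integral equation for \<open>c/a\<close> after cancelling \<open>d\<close>.\<close>

lemma dvd_if_powers_dvd:
  fixes a c d :: "'a::idom"
  assumes "noetherian TYPE('a)" "integrally_closed TYPE('a)"
    and nz: "a \<noteq> 0" "d \<noteq> 0" and dvd: "\<And>j. a ^ j dvd d * c ^ j"
  shows "a dvd c"
proof -
  obtain x where x: "\<And>j. d * c ^ j = a ^ j * x j" using dvd unfolding dvd_def by metis
  obtain n r where r: "x n = (\<Sum>i<n. r i * x i)" by (rule noetherian_sequence[OF assms(1)])
  define y where "y = to_fract c / to_fract a"
  have to_fract_power: "to_fract (z ^ j) = to_fract z ^ j" for z :: 'a and j
    by (induction j) simp_all
  have xy: "to_fract (x j) = to_fract d * y ^ j" for j
  proof -
    have "to_fract d * to_fract c ^ j = to_fract a ^ j * to_fract (x j)"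
      using arg_cong[OF x[of j], of to_fract] by (simp add: to_fract_power)
    then show ?thesis using nz by (simp add: y_def power_divide field_simps)
  qed
  define F where "F = monom 1 n - (\<Sum>i<n. monom (r i) i)"
  have cF: "coeff F i = (if i = n then 1 else if i < n then - r i else 0)" for i
    by (simp add: F_def coeff_sum)
  have deg: "degree F = n"
    by (rule antisym[OF degree_le le_degree]) (simp_all add: cF)
  have "to_fract d * y ^ n = (\<Sum>i<n. to_fract (r i) * (to_fract d * y ^ i))"
    using arg_cong[OF r, of to_fract] by (simp add: xy)
  also have "\<dots> = to_fract d * (\<Sum>i<n. to_fract (r i) * y ^ i)"
    by (simp add: sum_distrib_left mult_ac)
  finally have "y ^ n = (\<Sum>i<n. to_fract (r i) * y ^ i)" using nz by simp
  moreover have "degree (map_poly to_fract F) = n"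
    using deg by (subst degree_map_poly) auto
  ultimately have "poly (map_poly to_fract F) y = 0"
    by (simp add: poly_altdef coeff_map_poly cF sum_negf flip: lessThan_Suc_atMost)
  moreover have "lead_coeff F = 1" by (simp add: deg cF)
  ultimately obtain z where "y = to_fract z"
    using assms(2) unfolding integrally_closed_def by blast
  then have "to_fract c = to_fract (a * z)" using nz by (simp add: y_def field_simps)
  then have "c = a * z" by (simp only: to_fract_eq_iff)
  then show ?thesis by simp
qed

lemma coeff_power_in_coeff_prods:
  "w \<in> coeff_prods F m \<Longrightarrow> coeff F i ^ j * w \<in> coeff_prods F (m + j)"
proof (induction j)
  case (Suc j)
  then show ?case using coeff_prods_SucI[of "coeff F i ^ j * w" F "m + j" i] by (simp add: mult_ac)
qed simp

text \<open>A form of Gauss' lemma: a factor over the fraction field of a monic polynomial, normalised to be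
  monic, has its coefficients in the ring. Let \<open>a\<close> be the leading coefficient of \<open>F\<close> and \<open>m\<close> the
  degree of \<open>H\<close>. As all coefficients of \<open>FH\<close> are multiples of \<open>c\<close>, which is \<open>a\<close> times the leading
  coefficient of \<open>H\<close>, the Dedekind-Mertens lemma yields \<open>c(F)\<^sup>m\<^sup>+\<^sup>1 \<subseteq> a c(F)\<^sup>m\<close> and, by iteration,
  \<open>c(F)\<^sup>m\<^sup>+\<^sup>j \<subseteq> a\<^sup>j c(F)\<^sup>m\<close>. Hence \<open>a\<^sup>m\<close> is a common denominator for all powers of a coefficient of
  \<open>F\<close> divided by \<open>a\<close>.\<close>

lemma lead_coeff_dvd_of_dvd_monic:
  fixes F :: "'a::idom poly"
  assumes R: "noetherian TYPE('a)" "integrally_closed TYPE('a)"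
    and g: "lead_coeff g = 1" and c: "c \<noteq> 0" "smult c g = F * H"
  shows "lead_coeff F dvd coeff F i"
proof -
  have nz: "F \<noteq> 0" "H \<noteq> 0" using c g by auto
  define a b m where "a = lead_coeff F" and "b = lead_coeff H" and "m = degree H"
  have "lead_coeff (smult c g) = a * b"
    unfolding c(2) a_def b_def by (rule lead_coeff_mult)
  then have ab: "c = a * b" using g by (simp only: lead_coeff_smult mult_1_right)
  have ab0: "a \<noteq> 0" "b \<noteq> 0" using nz by (auto simp: a_def b_def)
  define W where "W = ideal_gen (coeff_prods F m)"
  have W: "is_ideal W" by (simp add: W_def)
  have top: "\<exists>z\<in>W. w = a * z" if w: "w \<in> coeff_prods F (Suc m)" for w
  proof -
    have "w * coeff H (degree H) \<in> {c * z | z. z \<in> W}"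
    proof (rule Dedekind_Mertens[OF _ _ _ _ w])
      show "0 \<in> {c * z | z. z \<in> W}" using ideal.subspace_0[OF W] by force
      show "x - y \<in> {c * z | z. z \<in> W}"
        if "x \<in> {c * z | z. z \<in> W}" "y \<in> {c * z | z. z \<in> W}" for x y
        using that ideal.subspace_diff[OF W] by (auto simp flip: right_diff_distrib)
      show "v * coeff (F * H) i \<in> {c * z | z. z \<in> W}" if "v \<in> coeff_prods F m" for v i
      proof -
        have "coeff g i * v \<in> W" unfolding W_def using that
          by (intro ideal.span_scale ideal.span_base)
        moreover have "v * coeff (F * H) i = c * (coeff g i * v)"
          by (simp flip: c(2))
        ultimately show ?thesis by blast
      qed
    qed (simp add: m_def)
    then obtain z where "z \<in> W" "w * b = a * b * z" by (auto simp: b_def ab)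
    then show ?thesis using ab0 by (intro bexI[of _ z]) (auto simp: mult_ac)
  qed
  have stepW: "\<exists>u\<in>W. coeff F i * z = a * u" if "z \<in> W" for z i
    using that unfolding W_def
  proof (induction rule: ideal.span_induct_alt)
    case base
    then show ?case by (intro bexI[of _ 0]) (simp_all add: ideal.span_zero)
  next
    case (step r x y)
    obtain u where u: "u \<in> W" "coeff F i * y = a * u" using step(2) by (auto simp: W_def)
    obtain v where v: "v \<in> W" "coeff F i * x = a * v"
      using top[OF coeff_prods_SucI[OF step(1)]] by blast
    have "coeff F i * (r * x + y) = a * (r * v + u)"
      using u v by (simp add: algebra_simps)
    then show ?case
      using u v W ideal.subspace_add ideal.subspace_scale unfolding W_def by metis
  qed
  have powers: "\<exists>z\<in>W. w = a ^ j * z" if "w \<in> coeff_prods F (m + j)" for w j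
    using that
  proof (induction j arbitrary: w)
    case 0
    then show ?case by (auto simp: W_def intro: ideal.span_base)
  next
    case (Suc j)
    obtain i v where iv: "w = coeff F i * v" "v \<in> coeff_prods F (m + j)"
      using Suc.prems by (auto elim: coeff_prods_SucE)
    obtain z where z: "z \<in> W" "v = a ^ j * z" using Suc.IH[OF iv(2)] by blast
    obtain u where u: "u \<in> W" "coeff F i * z = a * u" using stepW[OF z(1)] by blast
    have "w = a ^ j * (coeff F i * z)" by (simp add: iv(1) z(2) mult_ac)
    then show ?case using u by (intro bexI[of _ u]) (auto simp: mult_ac)
  qed
  have "a ^ j dvd a ^ m * coeff F i ^ j" for j
  proof -
    have "a ^ m * 1 \<in> coeff_prods F (0 + m)"
      unfolding a_def by (rule coeff_power_in_coeff_prods) simp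
    then have "coeff F i ^ j * a ^ m \<in> coeff_prods F (m + j)"
      by (intro coeff_power_in_coeff_prods) simp
    then obtain z where "coeff F i ^ j * a ^ m = a ^ j * z" using powers by blast
    then show ?thesis by (metis dvd_triv_left mult.commute)
  qed
  then show ?thesis
    using dvd_if_powers_dvd[OF R, of a "a ^ m"] ab0 unfolding a_def by simp
qed

lemma coeff_mult_notin_prime:
  assumes P: "P \<in> Spec" and "coeff A i \<notin> P" "coeff B j \<notin> P"
    and "\<And>k. k < i \<Longrightarrow> coeff A k \<in> P" "\<And>k. k < j \<Longrightarrow> coeff B k \<in> P"
  shows "coeff (A * B) (i + j) \<notin> P"
proof
  assume *: "coeff (A * B) (i + j) \<in> P"
  note Pi = SpecD(1)[OF P]
  have "(\<Sum>k\<in>{..i + j} - {i}. coeff A k * coeff B (i + j - k)) \<in> P"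
  proof (rule ideal.subspace_sum[OF Pi])
    fix k assume k: "k \<in> {..i + j} - {i}"
    show "coeff A k * coeff B (i + j - k) \<in> P"
    proof (cases "k < i")
      case True
      then show ?thesis
        using assms(4) ideal.subspace_scale[OF Pi] by (simp add: mult.commute)
    next
      case False
      then show ?thesis
        using k assms(5)[of "i + j - k"] by (intro ideal.subspace_scale[OF Pi]) auto
    qed
  qed
  moreover have "coeff (A * B) (i + j)
      = coeff A i * coeff B j + (\<Sum>k\<in>{..i + j} - {i}. coeff A k * coeff B (i + j - k))"
    unfolding coeff_mult by (subst sum.remove[of _ i]) auto
  ultimately have "coeff A i * coeff B j \<in> P"
    using ideal.subspace_diff[OF Pi *] by fastforce
  then show False using SpecD(3)[OF P] assms(2,3) by blast
qed

lemma monic_overI: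
  assumes "is_ideal I" "lead_coeff F = 1" "\<And>i. i < degree F \<Longrightarrow> coeff F i \<in> I"
  shows "monic_over I (degree F) F"
  unfolding monic_over_def lower_terms_def
proof (intro allI conjI impI)
  fix i
  show 0: "coeff (F - monom 1 (degree F)) i = 0" if "degree F \<le> i"
    using that assms(2) by (cases "i = degree F") (simp_all add: coeff_eq_0)
  show "coeff (F - monom 1 (degree F)) i \<in> I"
  proof (cases "i < degree F")
    case True
    then show ?thesis using assms(3) by simp
  next
    case False
    then show ?thesis using 0 ideal.subspace_0[OF assms(1)] by simp
  qed
qed

section \<open>Going down\<close>

locale normal_base_ext = ring_ext \<theta> for \<theta> :: "'r::idom \<Rightarrow> 's::idom" +
  assumes noetherian: "noetherian TYPE('r)" and normal: "integrally_closed TYPE('r)"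
begin

text \<open>A polynomial of least degree that vanishes at \<open>t\<close> divides a constant multiple of an integral
  equation of \<open>t\<close>, so by Gauss' lemma it can be made monic. Division by a monic polynomial leaves
  a remainder, which then vanishes by minimality.\<close>

lemma minimal_polynomial:
  obtains F where "lead_coeff F = 1" "ev t F = 0" "\<forall>G. ev t G = 0 \<longrightarrow> F dvd G"
proof -
  have "t \<in> extend \<theta> UNIV"
    using ideal.subspace_scale[OF is_ideal_extend hom_in_extend, of 1 UNIV t] by (simp add: hom_1)
  then obtain n g where "monic_over UNIV n g" and g: "ev t g = 0"
    using integral_over_ideal[of UNIV t] by auto
  then have g1: "lead_coeff g = 1" using monic_overD by metis
  then have "g \<noteq> 0" by auto
  then obtain F where F: "F \<noteq> 0" "ev t F = 0"
    and min: "\<And>G. G \<noteq> 0 \<Longrightarrow> ev t G = 0 \<Longrightarrow> degree F \<le> degree G"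
    using ex_has_least_nat[of "\<lambda>F. F \<noteq> 0 \<and> ev t F = 0" g degree] g by blast
  have mod0: "G = 0" if "ev t G = 0" "G = 0 \<or> degree G < degree F" for G
    using that min by (meson leD)
  obtain c H where c: "c \<noteq> 0" "smult c g = F * H + pseudo_mod g F"
    using pseudo_mod(1)[OF F(1)] by blast
  have "ev t (pseudo_mod g F) = 0"
    using arg_cong[OF c(2), of "ev t"] g F(2) by (simp add: ev_add ev_mult ev_smult)
  then have "smult c g = F * H" using mod0 pseudo_mod(2)[OF F(1)] c(2) by simp
  then have "lead_coeff F dvd coeff F i" for i
    using lead_coeff_dvd_of_dvd_monic[OF noetherian normal g1 c(1)] by blast
  then obtain E where E: "F = smult (lead_coeff F) E"
    using const_poly_dvd_iff[of "lead_coeff F" F] by (auto elim: dvdE)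
  then have deg: "degree E = degree F" using F(1) by (metis degree_smult_eq leading_coeff_0_iff)
  then have E1: "lead_coeff E = 1"
    using E F(1) by (metis lead_coeff_smult leading_coeff_0_iff mult_cancel_left1)
  have "\<theta> (lead_coeff F) * ev t E = 0" using F(2) E by (metis ev_smult)
  then have Et: "ev t E = 0" using F(1) by (simp add: hom_eq_0_iff)
  have "E dvd G" if G: "ev t G = 0" for G
  proof -
    obtain q r where qr: "pseudo_divmod G E = (q, r)" by fastforce
    have E0: "E \<noteq> 0" using E1 by auto
    have div: "G = E * q + r" "r = 0 \<or> degree r < degree E"
      using pseudo_divmod[OF E0 qr] E1 by simp_all
    have "ev t r = 0" using arg_cong[OF div(1), of "ev t"] G Et by (simp add: ev_add ev_mult)
    then have "r = 0" using mod0 div(2) deg by simp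
    then show ?thesis using div(1) by simp
  qed
  then show thesis using that E1 Et by blast
qed

text \<open>A prime that contains \<open>PS\<close> and avoids all \<open>r t\<close> with \<open>r \<in> R - P\<close> and \<open>t \<in> S - Q\<close> lies below \<open>Q\<close>
  and over \<open>P\<close>. To see that \<open>PS\<close> contains no such \<open>r t\<close>, substitute \<open>rX\<close> into an equation of \<open>r t\<close>
  that is integral over \<open>P\<close>. The result is divisible by the minimal polynomial of \<open>t\<close> and congruent
  to \<open>r\<^sup>n X\<^sup>n\<close> modulo \<open>P\<close>. As \<open>R/P\<close> is a domain, the minimal polynomial is itself congruent to a power
  of the variable, and thus a power of \<open>t\<close> lies in \<open>PS\<close> and hence in \<open>Q\<close>.\<close>

lemma going_down:
  assumes Q: "Q \<in> Spec" and P: "P \<in> Spec" "P \<subseteq> contract \<theta> Q"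
  obtains Q' where "Q' \<in> Spec" "Q' \<subseteq> Q" "contract \<theta> Q' = P"
proof -
  note Pi = SpecD[OF P(1)] and Qi = SpecD[OF Q]
  have key: "\<theta> r * t \<notin> extend \<theta> P" if r: "r \<notin> P" and t: "t \<notin> Q" for r t
  proof
    assume "\<theta> r * t \<in> extend \<theta> P"
    then obtain n g where g: "monic_over P n g" "ev (\<theta> r * t) g = 0"
      using integral_over_ideal[OF Pi(1)] by blast
    \<comment> \<open>The polynomial \<open>g(rX)\<close>.\<close>
    define G where "G = (\<Sum>i\<le>n. monom (coeff g i * r ^ i) i)"
    have cG: "coeff G i = (if i \<le> n then coeff g i * r ^ i else 0)" for i
      by (simp add: G_def coeff_sum coeff_monom)
    have "ev t (\<Sum>i\<in>A. monom (f i) i) = (\<Sum>i\<in>A. \<theta> (f i) * t ^ i)" for A f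
      by (induction A rule: infinite_finite_induct) (simp_all add: ev_0 ev_add ev_monom)
    then have "ev t G = 0"
      using g(2) monic_overD(4)[OF g(1)]
      by (simp add: G_def ev_altdef hom_mult hom_power power_mult_distrib mult_ac)
    moreover obtain F where F: "lead_coeff F = 1" "ev t F = 0" "\<forall>G. ev t G = 0 \<longrightarrow> F dvd G"
      by (rule minimal_polynomial[of t])
    ultimately obtain H where H: "G = F * H" by (auto elim: dvdE)
    have rn: "r ^ n \<notin> P" using Spec_power[OF P(1)] r by blast
    have Gn: "coeff G n = r ^ n" using monic_overD(1)[OF g(1)] by (simp add: cG)
    then have G0: "G \<noteq> 0" using rn ideal.subspace_0[OF Pi(1)] by (metis coeff_0)
    have "degree G = n"
    proof (rule antisym[OF degree_le le_degree])
      show "coeff G n \<noteq> 0" using Gn rn ideal.subspace_0[OF Pi(1)] by metis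
    qed (simp add: cG)
    \<comment> \<open>If a coefficient of \<open>F\<close> below the leading one were outside \<open>P\<close>, then \<open>F H\<close> would have such a
      coefficient in degree less than \<open>n\<close>.\<close>
    then have n: "n = degree F + degree H" using H G0 by (auto simp: degree_mult_eq)
    have GP: "coeff G i \<in> P" if "i < n" for i
      using that monic_overD(2)[OF g(1)] ideal.subspace_scale[OF Pi(1)]
      by (simp add: cG mult.commute)
    have "coeff F i \<in> P" if "i < degree F" for i
    proof (rule ccontr)
      assume "coeff F i \<notin> P"
      then obtain i' where i': "coeff F i' \<notin> P" "\<And>k. k < i' \<Longrightarrow> coeff F k \<in> P" "i' \<le> i"
        using LeastI[of "\<lambda>i. coeff F i \<notin> P"] not_less_Least[of _ "\<lambda>i. coeff F i \<notin> P"]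
          Least_le[of "\<lambda>i. coeff F i \<notin> P"] by blast
      have "\<exists>j. coeff H j \<notin> P"
      proof (rule ccontr)
        assume "\<not> ?thesis"
        then have "coeff G n \<in> P" unfolding H coeff_mult
          by (intro ideal.subspace_sum[OF Pi(1)] ideal.subspace_scale[OF Pi(1)]) auto
        then show False using rn Gn by simp
      qed
      then obtain j where j: "coeff H j \<notin> P" "\<And>k. k < j \<Longrightarrow> coeff H k \<in> P"
        using LeastI_ex[of "\<lambda>i. coeff H i \<notin> P"] not_less_Least[of _ "\<lambda>i. coeff H i \<notin> P"] by blast
      have "j \<le> degree H"
        using j(1) ideal.subspace_0[OF Pi(1)] by (metis coeff_eq_0 not_le)
      then have "i' + j < n" using n i'(3) that by simp
      then show False using coeff_mult_notin_prime[OF P(1) i'(1) j(1) i'(2) j(2)] GP H by blast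
    qed
    then have "monic_over P (degree F) F" by (rule monic_overI[OF Pi(1) F(1)])
    then have "t ^ degree F \<in> extend \<theta> P" using ev_monic_over_extend F(2) by blast
    then have "t ^ degree F \<in> Q" using extend_subset_iff[OF Qi(1)] P(2) by blast
    then show False using Spec_power[OF Q] t by blast
  qed
  define M where "M = {\<theta> r * t | r t. r \<notin> P \<and> t \<notin> Q}"
  have "1 \<in> M" unfolding M_def using hom_1 Pi(2) Qi(2) by (intro CollectI exI[of _ 1]) simp
  moreover have "a * b \<in> M" if ab: "a \<in> M" "b \<in> M" for a b
  proof -
    obtain r t u v where *: "a = \<theta> r * t" "b = \<theta> u * v" "r \<notin> P" "u \<notin> P" "t \<notin> Q" "v \<notin> Q"
      using ab unfolding M_def by blast
    then have "a * b = \<theta> (r * u) * (t * v)" by (simp add: hom_mult mult_ac)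
    moreover have "r * u \<notin> P" "t * v \<notin> Q" using * Pi(3) Qi(3) by blast+
    ultimately show ?thesis unfolding M_def by blast
  qed
  moreover have "extend \<theta> P \<inter> M = {}" using key unfolding M_def by blast
  ultimately obtain Q' where Q': "Q' \<in> Spec" "extend \<theta> P \<subseteq> Q'" "Q' \<inter> M = {}"
    using ex_prime_avoiding[OF is_ideal_extend, of M P] by metis
  have "t \<in> Q" if "t \<in> Q'" for t
  proof (rule ccontr)
    assume "t \<notin> Q"
    then have "\<theta> 1 * t \<in> M" unfolding M_def using Pi(2) by blast
    then show False using that Q'(3) by (auto simp: hom_1)
  qed
  moreover have "r \<in> P" if "\<theta> r \<in> Q'" for r
  proof (rule ccontr)
    assume "r \<notin> P"
    then have "\<theta> r * 1 \<in> M" unfolding M_def using Qi(2) by blast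
    then show False using that Q'(3) by auto
  qed
  moreover have "P \<subseteq> contract \<theta> Q'" using extend_subset_iff[OF SpecD(1)[OF Q'(1)]] Q'(2) by blast
  ultimately show thesis using that[OF Q'(1)] by (auto simp: contract_def)
qed

end

section \<open>The Cartier core\<close>

locale cartier_map =
  fixes q :: nat and \<phi> :: "'a::comm_ring_1 \<Rightarrow> 'a"
  assumes frob_linear: "frob_linear q \<phi>" and q_pos: "0 < q"
begin

lemma frob_scale: "\<phi> (r ^ q * x) = r * \<phi> x"
  using module_hom.scale[OF frob_linear[unfolded frob_linear_def], of r x]
  by (simp add: frob_scale_def)

lemma frob_scale_iter: "(\<phi> ^^ n) (r ^ (q ^ n) * x) = r * (\<phi> ^^ n) x"
proof (induction n arbitrary: r x)
  case (Suc n)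
  have "(\<phi> ^^ Suc n) (r ^ (q ^ Suc n) * x) = \<phi> ((\<phi> ^^ n) ((r ^ q) ^ (q ^ n) * x))"
    by (simp add: power_mult)
  also have "\<dots> = r * (\<phi> ^^ Suc n) x" by (simp add: Suc.IH frob_scale)
  finally show ?case .
qed simp

lemma add: "\<phi> (x + y) = \<phi> x + \<phi> y"
  using module_hom.add[OF frob_linear[unfolded frob_linear_def]] .

lemma zero: "\<phi> 0 = 0"
  using module_hom.zero[OF frob_linear[unfolded frob_linear_def]] .

lemma add_iter: "(\<phi> ^^ n) (x + y) = (\<phi> ^^ n) x + (\<phi> ^^ n) y"
  by (induction n) (simp_all add: add)

lemma zero_iter: "(\<phi> ^^ n) 0 = 0"
  by (induction n) (simp_all add: zero)

lemma in_cartier_core_iff: "r \<in> cartier_core \<phi> P \<longleftrightarrow> (\<forall>n x. (\<phi> ^^ n) (x * r) \<in> P)"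
  by (simp add: cartier_core_def ideal_root_def ideal.span_singleton image_subset_iff)

lemma cartier_core_subset: "cartier_core \<phi> P \<subseteq> P"
proof
  fix r assume "r \<in> cartier_core \<phi> P"
  then have "(\<phi> ^^ 0) (1 * r) \<in> P" unfolding in_cartier_core_iff by blast
  then show "r \<in> P" by simp
qed

lemma cartier_core_phi_ideal:
  assumes P: "is_ideal P"
  shows "cartier_core \<phi> P \<in> phi_ideals \<phi>"
proof -
  have "is_ideal (cartier_core \<phi> P)"
  proof (rule ideal.subspaceI)
    show "0 \<in> cartier_core \<phi> P"
      using ideal.subspace_0[OF P] by (simp add: in_cartier_core_iff zero_iter)
    show "x + y \<in> cartier_core \<phi> P" if "x \<in> cartier_core \<phi> P" "y \<in> cartier_core \<phi> P" for x y
      using that ideal.subspace_add[OF P]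
      by (simp add: in_cartier_core_iff distrib_left add_iter)
    show "c * x \<in> cartier_core \<phi> P" if "x \<in> cartier_core \<phi> P" for c x
      using that by (simp add: in_cartier_core_iff flip: mult.assoc)
  qed
  moreover have "\<phi> r \<in> cartier_core \<phi> P" if r: "r \<in> cartier_core \<phi> P" for r
    unfolding in_cartier_core_iff
  proof (intro allI)
    fix n x
    have "(\<phi> ^^ Suc n) (x ^ q * r) \<in> P" using r unfolding in_cartier_core_iff by blast
    then show "(\<phi> ^^ n) (x * \<phi> r) \<in> P" by (simp add: funpow_swap1 frob_scale)
  qed
  ultimately show ?thesis by (auto simp: phi_ideals_def)
qed

lemma cartier_core_greatest:
  assumes "I \<in> phi_ideals \<phi>" "I \<subseteq> P"
  shows "I \<subseteq> cartier_core \<phi> P"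
proof
  fix r assume r: "r \<in> I"
  have "(\<phi> ^^ n) y \<in> I" if "y \<in> I" for n y
    using that assms(1) by (induction n) (auto simp: phi_ideals_def)
  moreover have "x * r \<in> I" for x
    using r assms(1) ideal.subspace_scale by (auto simp: phi_ideals_def)
  ultimately show "r \<in> cartier_core \<phi> P" using assms(2) by (auto simp: in_cartier_core_iff)
qed

lemma cartier_core_eq: "P \<in> phi_ideals \<phi> \<Longrightarrow> cartier_core \<phi> P = P"
  using cartier_core_greatest[of P P] cartier_core_subset by blast

text \<open>If \<open>a\<close> and \<open>b\<close> are outside the core, some multiples of them are mapped outside \<open>P\<close> by powers of
  \<open>\<phi>\<close>, to \<open>u\<close> and \<open>v\<close> say. By linearity these can be nested: a multiple of \<open>a b\<close> is mapped to \<open>u v\<close>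
  by the composite power.\<close>

lemma cartier_core_Spec:
  assumes P: "P \<in> Spec"
  shows "cartier_core \<phi> P \<in> Spec"
proof (rule SpecI)
  show "is_ideal (cartier_core \<phi> P)"
    using cartier_core_phi_ideal[OF SpecD(1)[OF P]] by (simp add: phi_ideals_def)
  show "1 \<notin> cartier_core \<phi> P" using SpecD(2)[OF P] cartier_core_subset by blast
  fix a b assume ab: "a * b \<in> cartier_core \<phi> P"
  show "a \<in> cartier_core \<phi> P \<or> b \<in> cartier_core \<phi> P"
  proof (rule ccontr)
    assume "\<not> ?thesis"
    then obtain n x m y where u: "(\<phi> ^^ n) (x * a) \<notin> P" and v: "(\<phi> ^^ m) (y * b) \<notin> P"
      unfolding in_cartier_core_iff by blast
    define u v where "u = (\<phi> ^^ n) (x * a)" and "v = (\<phi> ^^ m) (y * b)"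
    \<comment> \<open>The exponent is chosen such that \<open>w * u\<close> contains the power of \<open>u\<close> that \<open>\<phi> ^^ m\<close> extracts.\<close>
    define w where "w = u ^ (q ^ m - 1) * (y * b)"
    have split: "z ^ (q ^ k) = z ^ (q ^ k - 1) * z" for z :: 'a and k
      using q_pos power_minus_mult[of "q ^ k" z] by simp
    have "u ^ (q ^ m) * (y * b) = w * u"
      by (subst split) (simp add: w_def mult_ac)
    then have "u * v = (\<phi> ^^ m) (w * u)" by (simp add: v_def flip: frob_scale_iter)
    also have "\<dots> = (\<phi> ^^ m) ((\<phi> ^^ n) (w ^ (q ^ n) * (x * a)))"
      by (simp add: u_def frob_scale_iter)
    also have "w ^ (q ^ n) = w ^ (q ^ n - 1) * w" by (rule split)
    finally have "u * v = (\<phi> ^^ (m + n))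
        ((w ^ (q ^ n - 1) * u ^ (q ^ m - 1) * y * x) * (a * b))"
      by (simp add: funpow_add w_def mult_ac)
    then have "u * v \<in> P" using ab unfolding in_cartier_core_iff by metis
    then show False using SpecD(3)[OF P] u v unfolding u_def v_def by blast
  qed
qed

lemma Schpec_eq:
  assumes "1 \<in> range \<phi>"
  shows "Schpec \<phi> = Spec \<inter> phi_ideals \<phi>"
  using assms SpecD(2) by (auto simp: Schpec_def)

lemma Schpec_iff:
  assumes "1 \<in> range \<phi>" "P \<in> Spec"
  shows "P \<in> Schpec \<phi> \<longleftrightarrow> cartier_core \<phi> P = P"
  using assms cartier_core_eq cartier_core_phi_ideal[OF SpecD(1)]
  unfolding Schpec_eq[OF assms(1)] by (metis IntI IntD2)

end

section \<open>Cartier cores in a finite extension\<close>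

locale cartier_ext = normal_base_ext \<theta> + R: cartier_map q \<phi> + S: cartier_map q \<psi>
  for \<theta> :: "'r::idom \<Rightarrow> 's::idom" and q \<phi> \<psi> +
  assumes surj: "surj \<phi>" and noetherian_ext: "noetherian TYPE('s)"
    and compat: "\<psi> (\<theta> r) = \<theta> (\<phi> r)"
begin

lemma contract_phi_ideal:
  assumes "J \<in> phi_ideals \<psi>"
  shows "contract \<theta> J \<in> phi_ideals \<phi>"
proof -
  have "\<phi> r \<in> contract \<theta> J" if "\<theta> r \<in> J" for r
    using that assms by (auto simp: phi_ideals_def contract_def simp flip: compat)
  then show ?thesis
    using assms is_ideal_contract by (auto simp: phi_ideals_def contract_def)
qed

lemma one_in_range: "1 \<in> range \<phi>" "1 \<in> range \<psi>"
proof -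
  show "1 \<in> range \<phi>" using surj by simp
  then obtain r where "\<phi> r = 1" by auto
  then have "\<psi> (\<theta> r) = 1" using compat hom_1 by simp
  then show "1 \<in> range \<psi>" by (metis rangeI)
qed

text \<open>One inclusion of the commutative square always holds, as the Cartier core is the largest
  \<open>\<phi>\<close>-ideal below a prime; the commutativity of the square thus amounts to the other one.\<close>

lemma contract_core_subset:
  assumes "Q \<in> Spec"
  shows "contract \<theta> (cartier_core \<psi> Q) \<subseteq> cartier_core \<phi> (contract \<theta> Q)"
proof (rule R.cartier_core_greatest)
  show "contract \<theta> (cartier_core \<psi> Q) \<in> phi_ideals \<phi>"
    by (intro contract_phi_ideal S.cartier_core_phi_ideal SpecD(1) assms)
  show "contract \<theta> (cartier_core \<psi> Q) \<subseteq> contract \<theta> Q"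
    using S.cartier_core_subset by (auto simp: contract_def)
qed

text \<open>The square of the theorem; all other conditions are compared with it.\<close>

definition core_commutes :: bool where
  "core_commutes \<longleftrightarrow>
     (\<forall>Q\<in>Spec. contract \<theta> (cartier_core \<psi> Q) = cartier_core \<phi> (contract \<theta> Q))"

lemma core_commutesI:
  assumes "\<And>Q. Q \<in> Spec \<Longrightarrow> cartier_core \<phi> (contract \<theta> Q) \<subseteq> contract \<theta> (cartier_core \<psi> Q)"
  shows core_commutes
  unfolding core_commutes_def using assms contract_core_subset by blast

lemma core_commutesD:
  "core_commutes \<Longrightarrow> Q \<in> Spec \<Longrightarrow>
    contract \<theta> (cartier_core \<psi> Q) = cartier_core \<phi> (contract \<theta> Q)"
  by (simp add: core_commutes_def)

text \<open>Continuity, applied to the closed set \<open>V(B)\<close> for the core \<open>B\<close> of \<open>Q \<inter> R\<close>, provides a \<open>\<psi>\<close>-ideal below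
  \<open>Q\<close> all of whose prime overideals contract to overideals of \<open>B\<close>; the core of \<open>Q\<close> is one of these.
  Conversely, the preimage of \<open>V(I)\<close> is the zero locus of the intersection of the cores of its points.\<close>

lemma continuous_iff:
  "continuous_map (CZpec \<psi>) (CZpec \<phi>) (contract \<theta>) \<longleftrightarrow> core_commutes"
proof
  assume cont: "continuous_map (CZpec \<psi>) (CZpec \<phi>) (contract \<theta>)"
  show core_commutes
  proof (rule core_commutesI)
    fix Q :: "'s set" assume Q: "Q \<in> Spec"
    define B where "B = cartier_core \<phi> (contract \<theta> Q)"
    have "B \<in> phi_ideals \<phi>"
      unfolding B_def by (intro R.cartier_core_phi_ideal SpecD(1) contract_Spec Q)
    then have "closedin (CZpec \<phi>) (zero_locus B)"
      using closedin_CZpec[OF R.frob_linear] by blast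
    then have "closedin (CZpec \<psi>) {Q \<in> Spec. contract \<theta> Q \<in> zero_locus B}"
      using closedin_continuous_map_preimage[OF cont] topspace_CZpec[OF S.frob_linear] by simp
    then obtain J where J: "J \<in> phi_ideals \<psi>"
      "{Q \<in> Spec. contract \<theta> Q \<in> zero_locus B} = zero_locus J"
      unfolding closedin_CZpec[OF S.frob_linear] by blast
    have "contract \<theta> Q \<in> zero_locus B"
      using R.cartier_core_subset contract_Spec[OF Q] by (auto simp: B_def zero_locus_def)
    then have "J \<subseteq> Q" using J(2) Q by (auto simp: zero_locus_def)
    then have "J \<subseteq> cartier_core \<psi> Q" by (rule S.cartier_core_greatest[OF J(1)])
    then have "cartier_core \<psi> Q \<in> zero_locus J"
      using S.cartier_core_Spec[OF Q] by (simp add: zero_locus_def)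
    then show "cartier_core \<phi> (contract \<theta> Q) \<subseteq> contract \<theta> (cartier_core \<psi> Q)"
      unfolding J(2)[symmetric] by (simp add: zero_locus_def B_def)
  qed
next
  assume comm: core_commutes
  show "continuous_map (CZpec \<psi>) (CZpec \<phi>) (contract \<theta>)"
    unfolding continuous_map_closedin topspace_CZpec[OF S.frob_linear]
      topspace_CZpec[OF R.frob_linear] closedin_CZpec[OF S.frob_linear]
      closedin_CZpec[OF R.frob_linear]
  proof (intro conjI allI impI)
    show "contract \<theta> \<in> Spec \<rightarrow> Spec" using contract_Spec by blast
  next
    fix C assume "\<exists>I\<in>phi_ideals \<phi>. C = zero_locus I"
    then obtain I where I: "I \<in> phi_ideals \<phi>" "C = zero_locus I" by blast
    define Z where "Z = {Q \<in> Spec. contract \<theta> Q \<in> C}"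
    define J where "J = (\<Inter>Q\<in>Z. cartier_core \<psi> Q)"
    have core: "cartier_core \<psi> Q \<in> phi_ideals \<psi>" if "Q \<in> Spec" for Q
      using that by (intro S.cartier_core_phi_ideal SpecD(1))
    have "is_ideal J" unfolding J_def
      using core by (intro ideal.subspace_Inter) (auto simp: phi_ideals_def Z_def)
    then have "J \<in> phi_ideals \<psi>"
      using core by (auto simp: phi_ideals_def J_def Z_def image_subset_iff)
    moreover have "Z = zero_locus J"
    proof
      show "Z \<subseteq> zero_locus J"
        using S.cartier_core_subset by (auto simp: zero_locus_def J_def Z_def)
      have "I \<subseteq> contract \<theta> J"
      proof -
        have "\<theta> ` I \<subseteq> cartier_core \<psi> Q" if Q: "Q \<in> Z" for Q
        proof -
          have "I \<subseteq> cartier_core \<phi> (contract \<theta> Q)"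
            using Q I by (intro R.cartier_core_greatest) (auto simp: Z_def zero_locus_def)
          also have "\<dots> = contract \<theta> (cartier_core \<psi> Q)"
            using core_commutesD[OF comm] Q by (simp add: Z_def)
          finally show ?thesis by (auto simp: contract_def)
        qed
        then show ?thesis by (auto simp: contract_def J_def)
      qed
      then show "zero_locus J \<subseteq> Z"
        unfolding Z_def I(2) using contract_Spec by (auto simp: zero_locus_def contract_def)
    qed
    ultimately show "\<exists>J\<in>phi_ideals \<psi>. {x \<in> Spec. contract \<theta> x \<in> C} = zero_locus J"
      unfolding Z_def by blast
  qed
qed

text \<open>If primes over \<open>\<phi>\<close>-ideals are \<open>\<psi>\<close>-ideals, the prime below \<open>Q\<close> that going down gives over the core
  of \<open>Q \<inter> R\<close> is contained in the core of \<open>Q\<close>. Conversely, if the square commutes, a prime over a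
  \<open>\<phi>\<close>-ideal has the same contraction as its core, and incomparability identifies the two.\<close>

lemma Schpec_iff_core_commutes:
  "Schpec \<psi> = {Q \<in> Spec. contract \<theta> Q \<in> Schpec \<phi>} \<longleftrightarrow> core_commutes"
proof
  assume eq: "Schpec \<psi> = {Q \<in> Spec. contract \<theta> Q \<in> Schpec \<phi>}"
  show core_commutes
  proof (rule core_commutesI)
    fix Q :: "'s set" assume Q: "Q \<in> Spec"
    define B where "B = cartier_core \<phi> (contract \<theta> Q)"
    have P: "contract \<theta> Q \<in> Spec" by (rule contract_Spec[OF Q])
    have B: "B \<in> Spec" "B \<in> phi_ideals \<phi>" "B \<subseteq> contract \<theta> Q"
      unfolding B_def
      by (simp_all add: P R.cartier_core_Spec R.cartier_core_phi_ideal SpecD(1)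
          R.cartier_core_subset)
    obtain Q' where Q': "Q' \<in> Spec" "Q' \<subseteq> Q" "contract \<theta> Q' = B"
      by (rule going_down[OF Q B(1,3)])
    then have "Q' \<in> Schpec \<psi>" using B R.Schpec_eq[OF one_in_range(1)] eq by auto
    then have "Q' \<in> phi_ideals \<psi>" by (simp add: Schpec_def)
    then have "Q' \<subseteq> cartier_core \<psi> Q" using Q'(2) by (rule S.cartier_core_greatest)
    then show "cartier_core \<phi> (contract \<theta> Q) \<subseteq> contract \<theta> (cartier_core \<psi> Q)"
      using Q'(3) by (auto simp: B_def contract_def)
  qed
next
  assume comm: core_commutes
  show "Schpec \<psi> = {Q \<in> Spec. contract \<theta> Q \<in> Schpec \<phi>}"
  proof (intro set_eqI iffI)
    fix Q assume "Q \<in> Schpec \<psi>"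
    then show "Q \<in> {Q \<in> Spec. contract \<theta> Q \<in> Schpec \<phi>}"
      using contract_Spec contract_phi_ideal
      by (auto simp: R.Schpec_eq[OF one_in_range(1)] S.Schpec_eq[OF one_in_range(2)])
  next
    fix Q assume "Q \<in> {Q \<in> Spec. contract \<theta> Q \<in> Schpec \<phi>}"
    then have Q: "Q \<in> Spec" "contract \<theta> Q \<in> Schpec \<phi>" by auto
    then have "contract \<theta> (cartier_core \<psi> Q) = contract \<theta> Q"
      using core_commutesD[OF comm] R.Schpec_iff[OF one_in_range(1) contract_Spec] by simp
    then have "cartier_core \<psi> Q = Q"
      by (intro incomparable Q(1) S.cartier_core_Spec S.cartier_core_subset)
    then show "Q \<in> Schpec \<psi>" using S.Schpec_iff[OF one_in_range(2) Q(1)] by simp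
  qed
qed

text \<open>The inclusion that is not a restatement of the square comes from going up: a prime over the core
  of \<open>P\<close> lies below a prime \<open>Q\<close> over \<open>P\<close>, and it is a \<open>\<psi>\<close>-ideal, so it is contained in the core of \<open>Q\<close>
  and equals it by incomparability.\<close>

lemma fibre_iff_core_commutes:
  "(\<forall>P\<in>Spec. {Q\<in>Spec. contract \<theta> Q = cartier_core \<phi> P} =
      cartier_core \<psi> ` {Q\<in>Spec. contract \<theta> Q = P}) \<longleftrightarrow> core_commutes" (is "?d \<longleftrightarrow> _")
proof
  assume d: ?d
  show core_commutes
  proof (rule core_commutesI)
    fix Q :: "'s set" assume Q: "Q \<in> Spec"
    then have "cartier_core \<psi> Q \<in> {Q'\<in>Spec. contract \<theta> Q' = cartier_core \<phi> (contract \<theta> Q)}"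
      using d contract_Spec[OF Q] by auto
    then show "cartier_core \<phi> (contract \<theta> Q) \<subseteq> contract \<theta> (cartier_core \<psi> Q)" by simp
  qed
next
  assume comm: core_commutes
  show ?d
  proof (intro ballI set_eqI iffI)
    fix P :: "'r set" and Q' assume P: "P \<in> Spec"
      and "Q' \<in> {Q\<in>Spec. contract \<theta> Q = cartier_core \<phi> P}"
    then have Q': "Q' \<in> Spec" "contract \<theta> Q' = cartier_core \<phi> P" by auto
    obtain Q where Q: "Q \<in> Spec" "Q' \<subseteq> Q" "contract \<theta> Q = P"
      using going_up[OF Q'(1) P] Q'(2) R.cartier_core_subset by metis
    have "Q' \<in> Schpec \<psi>"
      unfolding Schpec_iff_core_commutes[THEN iffD2, OF comm]
      using Q' P R.cartier_core_Spec R.cartier_core_phi_ideal SpecD(1)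
        R.Schpec_eq[OF one_in_range(1)] by auto
    then have "Q' \<subseteq> cartier_core \<psi> Q"
      using Q(2) by (intro S.cartier_core_greatest) (auto simp: Schpec_def)
    then have "Q' = cartier_core \<psi> Q"
      using core_commutesD[OF comm Q(1)] Q(3) Q'
      by (intro incomparable S.cartier_core_Spec Q(1)) auto
    then show "Q' \<in> cartier_core \<psi> ` {Q\<in>Spec. contract \<theta> Q = P}" using Q by blast
  next
    fix P :: "'r set" and Q' assume P: "P \<in> Spec"
      and "Q' \<in> cartier_core \<psi> ` {Q\<in>Spec. contract \<theta> Q = P}"
    then obtain Q where Q: "Q \<in> Spec" "contract \<theta> Q = P" "Q' = cartier_core \<psi> Q" by blast
    then show "Q' \<in> {Q\<in>Spec. contract \<theta> Q = cartier_core \<phi> P}"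
      using core_commutesD[OF comm Q(1)] S.cartier_core_Spec by simp
  qed
qed

text \<open>By going down, every prime that contains \<open>PS\<close> contains a prime over \<open>P\<close>.\<close>

lemma in_radical_extend_iff:
  assumes P: "P \<in> Spec"
  shows "x \<in> radical (extend \<theta> P) \<longleftrightarrow> (\<forall>Q\<in>Spec. contract \<theta> Q = P \<longrightarrow> x \<in> Q)"
proof -
  have rad: "radical (extend \<theta> P) = \<Inter>(zero_locus (extend \<theta> P))"
    by (rule radical_eq_Inter_primes[OF is_ideal_extend])
  have loc: "Q \<in> zero_locus (extend \<theta> P) \<longleftrightarrow> Q \<in> Spec \<and> P \<subseteq> contract \<theta> Q" for Q
    using extend_subset_iff[OF SpecD(1)] by (auto simp: zero_locus_def)
  show ?thesis
  proof
    assume "x \<in> radical (extend \<theta> P)"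
    then show "\<forall>Q\<in>Spec. contract \<theta> Q = P \<longrightarrow> x \<in> Q" using rad loc by auto
  next
    assume x: "\<forall>Q\<in>Spec. contract \<theta> Q = P \<longrightarrow> x \<in> Q"
    have "x \<in> Q" if Q: "Q \<in> Spec" "P \<subseteq> contract \<theta> Q" for Q
    proof -
      obtain Q' where "Q' \<in> Spec" "Q' \<subseteq> Q" "contract \<theta> Q' = P"
        by (rule going_down[OF Q(1) P Q(2)])
      then show ?thesis using x by blast
    qed
    then show "x \<in> radical (extend \<theta> P)" using rad loc by auto
  qed
qed

text \<open>By the description of the radical, an associated prime contains no element of \<open>R\<close> outside \<open>P\<close>;
  by incomparability, all primes over \<open>P\<close> are minimal over \<open>PS\<close> and therefore associated.\<close>

lemma Ass_radical_extend:
  assumes P: "P \<in> Spec"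
  shows "Ass_quotient (radical (extend \<theta> P)) = {Q \<in> Spec. contract \<theta> Q = P}"
proof (intro set_eqI iffI)
  fix Q assume "Q \<in> Ass_quotient (radical (extend \<theta> P))"
  then obtain x where Q: "Q \<in> Spec" and x: "Q = {a. a * x \<in> radical (extend \<theta> P)}"
    unfolding Ass_quotient_def by blast
  have "x \<notin> radical (extend \<theta> P)" using SpecD(2)[OF Q] x by auto
  then obtain Q' where Q': "Q' \<in> Spec" "contract \<theta> Q' = P" "x \<notin> Q'"
    using in_radical_extend_iff[OF P] by blast
  have "r \<in> P" if "\<theta> r \<in> Q" for r
  proof -
    have "\<theta> r * x \<in> Q'" using that x Q' in_radical_extend_iff[OF P] by blast
    then have "\<theta> r \<in> Q'" using SpecD(3)[OF Q'(1)] Q'(3) by blast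
    then show ?thesis using Q'(2) by (auto simp: contract_def)
  qed
  moreover have "\<theta> r \<in> Q" if r: "r \<in> P" for r
  proof -
    have "x * \<theta> r \<in> Q''" if "Q'' \<in> Spec" "contract \<theta> Q'' = P" for Q''
      using r that ideal.subspace_scale[OF SpecD(1)[OF that(1)]] by (auto simp: contract_def)
    then show ?thesis using x in_radical_extend_iff[OF P] by (auto simp: mult.commute)
  qed
  ultimately show "Q \<in> {Q \<in> Spec. contract \<theta> Q = P}" using Q by (auto simp: contract_def)
next
  fix Q assume "Q \<in> {Q \<in> Spec. contract \<theta> Q = P}"
  then have Q: "Q \<in> Spec" "contract \<theta> Q = P" by auto
  show "Q \<in> Ass_quotient (radical (extend \<theta> P))"
  proof (rule minimal_prime_in_Ass[OF noetherian_ext is_ideal_extend Q(1)])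
    show "extend \<theta> P \<subseteq> Q" using extend_subset_iff[OF SpecD(1)[OF Q(1)]] Q(2) by simp
    fix Q' assume Q': "Q' \<in> Spec" "extend \<theta> P \<subseteq> Q'" "Q' \<subseteq> Q"
    then have "contract \<theta> Q' = contract \<theta> Q"
      using extend_subset_iff[OF SpecD(1)[OF Q'(1)]] Q(2) by (auto simp: contract_def)
    then show "Q' = Q" by (rule incomparable[OF Q(1) Q'(1,3)])
  qed
qed

text \<open>Both sides are intersections of primes, over the two fibres that the condition on fibres compares.
  For the converse, the intersection on the right is contained in the core of each prime over \<open>P\<close>,
  which gives the missing inclusion of the square.\<close>

lemma radical_iff_core_commutes:
  "(\<forall>P\<in>Spec. radical (extend \<theta> (cartier_core \<phi> P)) =
      (\<Inter>Q\<in>Ass_quotient (radical (extend \<theta> P)). cartier_core \<psi> Q)) \<longleftrightarrow> core_commutes"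
  (is "?c \<longleftrightarrow> _")
proof
  assume c: ?c
  show core_commutes
  proof (rule core_commutesI)
    fix Q :: "'s set" assume Q: "Q \<in> Spec"
    have P: "contract \<theta> Q \<in> Spec" by (rule contract_Spec[OF Q])
    have "extend \<theta> (cartier_core \<phi> (contract \<theta> Q)) \<subseteq> radical (extend \<theta> (cartier_core \<phi> (contract \<theta> Q)))"
      unfolding radical_def by (metis (mono_tags, lifting) mem_Collect_eq power_one_right subsetI)
    also have "\<dots> \<subseteq> cartier_core \<psi> Q"
      using c P Q by (auto simp: Ass_radical_extend)
    finally show "cartier_core \<phi> (contract \<theta> Q) \<subseteq> contract \<theta> (cartier_core \<psi> Q)"
      using extend_subset_iff[OF SpecD(1)[OF S.cartier_core_Spec[OF Q]]] by blast
  qed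
next
  assume core_commutes
  then have d: "{Q\<in>Spec. contract \<theta> Q = cartier_core \<phi> P} =
      cartier_core \<psi> ` {Q\<in>Spec. contract \<theta> Q = P}" if "P \<in> Spec" for P
    using that fibre_iff_core_commutes by blast
  show ?c
  proof
    fix P :: "'r set" assume P: "P \<in> Spec"
    have "radical (extend \<theta> (cartier_core \<phi> P)) = \<Inter>{Q\<in>Spec. contract \<theta> Q = cartier_core \<phi> P}"
      using in_radical_extend_iff[OF R.cartier_core_Spec[OF P]] by blast
    then show "radical (extend \<theta> (cartier_core \<phi> P)) =
        (\<Inter>Q\<in>Ass_quotient (radical (extend \<theta> P)). cartier_core \<psi> Q)"
      unfolding d[OF P] Ass_radical_extend[OF P] .
  qed
qed

end

section \<open>The equivalence\<close>

theorem theoremA: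
  fixes p e q :: nat
    and \<phi> :: "'r::idom \<Rightarrow> 'r" and \<psi> :: "'s::idom \<Rightarrow> 's"
    and \<theta> :: "'r \<Rightarrow> 's"
  assumes "prime p" and "e \<ge> 1" and "q = p ^ e"
    and "CHAR('r) = p"
    and "noetherian TYPE('r)" and "noetherian TYPE('s)"
    and "integrally_closed TYPE('r)" and "integrally_closed TYPE('s)"
    and "F_finite TYPE('r)"
    and "frob_linear q \<phi>" and "surj \<phi>"
    and "finite_extension \<theta>"
    and "frob_linear q \<psi>" and "\<forall>r. \<psi> (\<theta> r) = \<theta> (\<phi> r)"
  shows
    "(continuous_map (CZpec \<psi>) (CZpec \<phi>) (contract \<theta>)
        \<longleftrightarrow> (\<forall>Q\<in>Spec. contract \<theta> (cartier_core \<psi> Q) = cartier_core \<phi> (contract \<theta> Q)))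
     \<and> ((\<forall>Q\<in>Spec. contract \<theta> (cartier_core \<psi> Q) = cartier_core \<phi> (contract \<theta> Q))
        \<longleftrightarrow> (\<forall>P\<in>Spec. radical (extend \<theta> (cartier_core \<phi> P)) =
               (\<Inter>Q\<in>Ass_quotient (radical (extend \<theta> P)). cartier_core \<psi> Q)))
     \<and> ((\<forall>P\<in>Spec. radical (extend \<theta> (cartier_core \<phi> P)) =
               (\<Inter>Q\<in>Ass_quotient (radical (extend \<theta> P)). cartier_core \<psi> Q))
        \<longleftrightarrow> (\<forall>P\<in>Spec. {Q\<in>Spec. contract \<theta> Q = cartier_core \<phi> P} =
               cartier_core \<psi> ` {Q\<in>Spec. contract \<theta> Q = P}))
     \<and> ((\<forall>P\<in>Spec. {Q\<in>Spec. contract \<theta> Q = cartier_core \<phi> P} =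
               cartier_core \<psi> ` {Q\<in>Spec. contract \<theta> Q = P})
        \<longleftrightarrow> Schpec \<psi> = {Q\<in>Spec. contract \<theta> Q \<in> Schpec \<phi>})"
proof -
  have "0 < q" using assms(1,3) by (simp add: prime_gt_0_nat)
  then interpret cartier_ext \<theta> q \<phi> \<psi>
    using assms by unfold_locales auto
  show ?thesis
    unfolding continuous_iff radical_iff_core_commutes fibre_iff_core_commutes
      Schpec_iff_core_commutes core_commutes_def[symmetric]
    by simp
qed

end
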